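(* Let $p_1,\dots,p_n\in\mathbb{R}^2$ be distinct points and let $u:\mathbb{R}^2\setminus\{p_1,\dots,p_n\}\to\mathbb{R}$ be a $\mathcal{C}^2$ solution of $u_{xx}u_{yy}-u_{xy}^2=0$ with isolated singularities at the points $p_i$. Assume there exists a point $p\in\mathcal{N}$ such that $r(p)$ is a line, and let $S(p)\subseteq\mathbb{R}^2\setminus\{p_1,\dots,p_n\}$ be the maximal open strip containing $r(p)$. Then $u$ is given in $S(p)$ by $$u(xe_1+ye_2)=\alpha(x)+v_0\,y,\qquad y\in\mathbb{R},$$ for a $\mathcal{C}^2$ function $\alpha(x)$, a constant $v_0\in\mathbb{R}$, and an orthonormal basis $\{e_1,e_2\}$ of $\mathbb{R}^2$ where $e_2$ is parallel to $r(p)$. Moreover: 1) if $q\in\mathcal{N}$ is such that $r(q)$ is a line, then $r(q)\subseteq S(p)$; 2) if $r$ is a line contained in $\mathcal{U}$, then $r\subseteq S(p)$.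
   Context: "$u$ has an isolated singularity at $p_i$" means that $u$ cannot be extended to $p_i$ as a $\mathcal{C}^2$ function. Let $\Omega=\mathbb{R}^2\setminus\{p_1,\dots,p_n\}$. $\mathcal{N}\subseteq\Omega$ is the open set of points where the Hessian matrix of $u$ is not zero, and $\mathcal{U}=\Omega\setminus\mathcal{N}$. By a known result of Hartman and Nirenberg, for every $p\in\mathcal{N}$ there is a (unique) line $\ell$ through $p$ such that the connected component of $\ell\cap\Omega$ containing $p$ consists of points of $\mathcal{N}$ and the gradient of $u$ is constant on it; this connected component is denoted $r(p)$. Thus $r(p)$ is a line, or an open half-line with end point at a singular point, or an open segment with end points at two singular points. An open strip is a region $\{xe_1+ye_2: x\in I,\ y\in\mathbb{R}\}$, where $\{e_1,e_2\}$ is an orthonormal basis of $\mathbb{R}^2$ and $I\subseteq\mathbb{R}$ is a nonempty open interval, possibly unbounded (so open half-planes and $\mathbb{R}^2$ are included). *)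

theory Defs
  imports "HOL-Analysis.Analysis"
begin

definition partial_deriv :: "'a::euclidean_space \<Rightarrow> ('a \<Rightarrow> real) \<Rightarrow> 'a \<Rightarrow> real" where
  "partial_deriv b f x = frechet_derivative f (at x) b"

text \<open>The next two notions are meant for open sets only: the derivatives are taken in the
  ambient space. For functions of one real variable, the only basis vector is 1.\<close>

definition C1_on :: "'a::euclidean_space set \<Rightarrow> ('a \<Rightarrow> real) \<Rightarrow> bool" where
  "C1_on S f \<longleftrightarrow> (\<forall>x\<in>S. f differentiable (at x)) \<and>
    (\<forall>b\<in>Basis. continuous_on S (partial_deriv b f))"

definition C2_on :: "'a::euclidean_space set \<Rightarrow> ('a \<Rightarrow> real) \<Rightarrow> bool" where
  "C2_on S f \<longleftrightarrow> C1_on S f \<and> (\<forall>b\<in>Basis. C1_on S (partial_deriv b f))"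

definition gradient :: "(real^2 \<Rightarrow> real) \<Rightarrow> real^2 \<Rightarrow> real^2" where
  "gradient u x = (\<chi> i. partial_deriv (axis i 1) u x)"

definition hessian :: "(real^2 \<Rightarrow> real) \<Rightarrow> real^2 \<Rightarrow> real^2^2" where
  "hessian u x = (\<chi> i j. partial_deriv (axis j 1) (partial_deriv (axis i 1) u) x)"

definition degenerate_monge_ampere_on :: "(real^2) set \<Rightarrow> (real^2 \<Rightarrow> real) \<Rightarrow> bool" where
  "degenerate_monge_ampere_on \<Omega> u \<longleftrightarrow>
    (\<forall>x\<in>\<Omega>. hessian u x $ 1 $ 1 * hessian u x $ 2 $ 2 - (hessian u x $ 1 $ 2)\<^sup>2 = 0)"

definition C2_singular_at :: "(real^2) set \<Rightarrow> (real^2 \<Rightarrow> real) \<Rightarrow> real^2 \<Rightarrow> bool" where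
  "C2_singular_at \<Omega> u p \<longleftrightarrow> \<not> (\<exists>v. C2_on (insert p \<Omega>) v \<and> (\<forall>x\<in>\<Omega>. v x = u x))"

definition nonflat_set :: "(real^2) set \<Rightarrow> (real^2 \<Rightarrow> real) \<Rightarrow> (real^2) set" where
  "nonflat_set \<Omega> u = {x \<in> \<Omega>. hessian u x \<noteq> 0}"

definition flat_set :: "(real^2) set \<Rightarrow> (real^2 \<Rightarrow> real) \<Rightarrow> (real^2) set" where
  "flat_set \<Omega> u = \<Omega> - nonflat_set \<Omega> u"

definition is_line :: "(real^2) set \<Rightarrow> bool" where
  "is_line L \<longleftrightarrow> affine L \<and> aff_dim L = 1"

text \<open>The line through a point of the nonflat set provided by the theorem of Hartman and Nirenberg
  (existence and uniqueness hold for solutions of the degenerate equation), and the set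
  \<open>r(p)\<close>.\<close>

definition leaf_line :: "(real^2) set \<Rightarrow> (real^2 \<Rightarrow> real) \<Rightarrow> real^2 \<Rightarrow> (real^2) set" where
  "leaf_line \<Omega> u p = (THE L. is_line L \<and> p \<in> L \<and>
    connected_component_set (L \<inter> \<Omega>) p \<subseteq> nonflat_set \<Omega> u \<and>
    gradient u constant_on connected_component_set (L \<inter> \<Omega>) p)"

definition leaf :: "(real^2) set \<Rightarrow> (real^2 \<Rightarrow> real) \<Rightarrow> real^2 \<Rightarrow> (real^2) set" where
  "leaf \<Omega> u p = connected_component_set (leaf_line \<Omega> u p \<inter> \<Omega>) p"

definition orthonormal_basis :: "real^2 \<Rightarrow> real^2 \<Rightarrow> bool" where
  "orthonormal_basis e1 e2 \<longleftrightarrow> norm e1 = 1 \<and> norm e2 = 1 \<and> orthogonal e1 e2"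

definition strip :: "real^2 \<Rightarrow> real^2 \<Rightarrow> real set \<Rightarrow> (real^2) set" where
  "strip e1 e2 I = {x *\<^sub>R e1 + y *\<^sub>R e2 | x y. x \<in> I}"

definition open_interval :: "real set \<Rightarrow> bool" where
  "open_interval I \<longleftrightarrow> open I \<and> is_interval I \<and> I \<noteq> {}"

definition open_strip :: "(real^2) set \<Rightarrow> bool" where
  "open_strip S \<longleftrightarrow> (\<exists>e1 e2 I. orthonormal_basis e1 e2 \<and> open_interval I \<and> S = strip e1 e2 I)"

definition maximal_strip :: "(real^2) set \<Rightarrow> (real^2) set \<Rightarrow> (real^2) set" where
  "maximal_strip \<Omega> R = (THE S. open_strip S \<and> R \<subseteq> S \<and> S \<subseteq> \<Omega> \<and>
    (\<forall>T. open_strip T \<and> R \<subseteq> T \<and> T \<subseteq> \<Omega> \<and> S \<subseteq> T \<longrightarrow> T = S))"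

end

theory Submission
  imports Defs
begin

text \<open>
  Where the Hessian has rank one, the level curves of the gradient are straight, and in coordinates
  \<open>(x, y)\<close> with the \<open>y\<close>-axis along such a curve \<open>1 / u\<^sub>x\<^sub>x\<close> is an affine function of \<open>y\<close>. Hence the
  Hessian cannot degenerate at a finite distance along the curve, and the leaf goes on until it
  leaves the domain (Hartman and Nirenberg).

  If a leaf is a full line, no other leaf can cross it. A leaf that starts in the maximal strip and
  is not parallel to the line would hit the line before meeting a singular point, so \<open>u\<close> depends on
  \<open>y\<close> only through a linear term. Let now a second line be parallel to the first and free of
  crossings as well. Every non-parallel leaf between the two is a segment joining two singular
  points. These segments are finitely many while non-parallelism is an open condition, so there are
  none. Thus \<open>u = \<alpha>(x) + v\<^sub>0 y\<close> between the two lines, every singularity there is removable, and so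
  there are no singular points between the lines.
\<close>

section \<open>Gradient and Hessian\<close>

text \<open>The inverse function theorem replaces it: one component of the gradient is taken as a
  coordinate. Neighbouring level curves are then straight, and \<open>1 / u\<^sub>x\<^sub>x\<close>
  is the rate at which they spread. Passing to the reciprocal is essential: being nonzero is not
  preserved in limits, but an equation \<open>u\<^sub>x\<^sub>x * (c + d * t) = 1\<close> is.
  Crossings are impossible because at a common point the Hessian would annihilate two independent
  vectors and so vanish, although it stays nonzero along a leaf. A flat line obstructs leaves in the
  same way. If no singular point projects between a point and the line, one obstructing line is
  enough. Otherwise a leaf may end at a singular point first, and lines on both sides are needed.
  Symmetry of the Hessian makes the component of the gradient along the line stationary in all
  directions. Finitely many punctures do not disconnect a strip, so this component is a single
  constant around every puncture; this is what makes the local extensions fit.\<close>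

lemma has_derivative_gradient:
  assumes "f differentiable (at z)"
  shows "(f has_derivative (\<lambda>h. gradient f z \<bullet> h)) (at z)"
proof -
  let ?D = "frechet_derivative f (at z)"
  have D: "(f has_derivative ?D) (at z)"
    using assms frechet_derivative_works by blast
  then interpret bounded_linear ?D
    by (rule has_derivative_bounded_linear)
  have "?D h = gradient f z \<bullet> h" for h
  proof -
    have "?D h = ?D (\<Sum>i\<in>UNIV. h $ i *\<^sub>R axis i 1)"
      using basis_expansion[of h] by (simp add: scalar_mult_eq_scaleR)
    also have "\<dots> = (\<Sum>i\<in>UNIV. h $ i * ?D (axis i 1))"
      by (simp only: sum scale real_scaleR_def)
    finally show ?thesis
      by (simp add: gradient_def partial_deriv_def inner_vec_def mult.commute)
  qed
  then have "?D = (\<lambda>h. gradient f z \<bullet> h)"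
    by blast
  then show ?thesis
    using D by simp
qed

lemma axis_in_Basis: "axis i (1::real) \<in> (Basis :: (real^2) set)"
  by (simp add: axis_in_Basis_iff)

lemma C2_on_imp_has_derivative:
  assumes "C2_on S f" "z \<in> S"
  shows "(f has_derivative (\<lambda>h. gradient f z \<bullet> h)) (at z)"
  using assms by (auto simp: C2_on_def C1_on_def intro: has_derivative_gradient)

lemma C2_on_imp_gradient_has_derivative:
  assumes "C2_on S f" "z \<in> S"
  shows "(gradient f has_derivative (\<lambda>h. hessian f z *v h)) (at z)"
proof -
  have "(partial_deriv (axis i 1) f has_derivative
      (\<lambda>h. gradient (partial_deriv (axis i 1) f) z \<bullet> h)) (at z)" for i
    using assms axis_in_Basis[of i]
    by (intro has_derivative_gradient) (auto simp: C2_on_def C1_on_def)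
  moreover have "gradient (partial_deriv (axis i 1) f) z \<bullet> h = (hessian f z *v h) $ i" for i h
    by (simp add: gradient_def hessian_def inner_vec_def matrix_vector_mult_def)
  ultimately have *: "(partial_deriv (axis i 1) f has_derivative (\<lambda>h. (hessian f z *v h) $ i)) (at z)" for i
    by simp
  have "((\<lambda>x. gradient f x $ i) has_derivative (\<lambda>h. (hessian f z *v h) $ i)) (at z)" for i
    using * by (simp add: gradient_def)
  then show ?thesis
    by (subst has_derivative_componentwise_within) (auto simp: Basis_vec_def inner_axis)
qed

lemma C2_on_imp_continuous_on_hessian:
  assumes "C2_on S f"
  shows "continuous_on S (hessian f)"
  using assms axis_in_Basis unfolding hessian_def[abs_def]
  by (auto simp: C2_on_def C1_on_def intro!: continuous_on_vec_lambda)

section \<open>Symmetry of the second derivative\<close>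

lemma second_difference_mvt:
  fixes f :: "'a::euclidean_space \<Rightarrow> real"
  assumes f: "\<And>z. z \<in> S \<Longrightarrow> (f has_derivative (\<lambda>h. g z \<bullet> h)) (at z)"
    and g: "\<And>z. z \<in> S \<Longrightarrow> (g has_derivative H z) (at z)"
    and S: "\<And>\<sigma> \<tau>. 0 \<le> \<sigma> \<Longrightarrow> \<sigma> \<le> t \<Longrightarrow> 0 \<le> \<tau> \<Longrightarrow> \<tau> \<le> t \<Longrightarrow> z + \<sigma> *\<^sub>R h + \<tau> *\<^sub>R k \<in> S"
    and t: "0 < t"
  shows "\<exists>\<sigma> \<tau>. 0 \<le> \<sigma> \<and> \<sigma> \<le> t \<and> 0 \<le> \<tau> \<and> \<tau> \<le> t \<and>
    f (z + t *\<^sub>R h + t *\<^sub>R k) - f (z + t *\<^sub>R h) - f (z + t *\<^sub>R k) + f z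
      = t\<^sup>2 * (H (z + \<sigma> *\<^sub>R h + \<tau> *\<^sub>R k) k \<bullet> h)"
proof -
  define \<psi> where "\<psi> s = f (z + s *\<^sub>R h + t *\<^sub>R k) - f (z + s *\<^sub>R h)" for s
  have S0: "z + \<sigma> *\<^sub>R h \<in> S" if "0 \<le> \<sigma>" "\<sigma> \<le> t" for \<sigma>
    using S[of \<sigma> 0] that t by simp
  have f1: "((\<lambda>s. f (z + s *\<^sub>R h + c)) has_real_derivative g (z + s *\<^sub>R h + c) \<bullet> h) (at s)"
    if "z + s *\<^sub>R h + c \<in> S" for s c
  proof -
    have "((\<lambda>s. z + s *\<^sub>R h + c) has_derivative (\<lambda>x. x *\<^sub>R h)) (at s)"
      by (auto intro!: derivative_eq_intros)
    from has_derivative_compose[OF this f[OF that]] show ?thesis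
      by (simp add: has_field_derivative_def mult.commute[of _ "_ \<bullet> _"] mult_commute_abs)
  qed
  have "(\<psi> has_real_derivative (g (z + s *\<^sub>R h + t *\<^sub>R k) - g (z + s *\<^sub>R h)) \<bullet> h) (at s)"
    if "0 \<le> s" "s \<le> t" for s
    unfolding \<psi>_def[abs_def] inner_diff_left
    using f1[of s "t *\<^sub>R k"] f1[of s 0] S[of s t] S0[of s] that t
    by (intro DERIV_diff) auto
  from MVT2[OF t this] obtain \<sigma> where \<sigma>: "0 < \<sigma>" "\<sigma> < t"
    and 1: "\<psi> t - \<psi> 0 = t * ((g (z + \<sigma> *\<^sub>R h + t *\<^sub>R k) - g (z + \<sigma> *\<^sub>R h)) \<bullet> h)"
    by auto
  have g1: "((\<lambda>s. g (z + \<sigma> *\<^sub>R h + s *\<^sub>R k) \<bullet> h) has_real_derivative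
      H (z + \<sigma> *\<^sub>R h + s *\<^sub>R k) k \<bullet> h) (at s)" if "0 \<le> s" "s \<le> t" for s
  proof -
    have m: "z + \<sigma> *\<^sub>R h + s *\<^sub>R k \<in> S"
      using S[of \<sigma> s] \<sigma> that by simp
    interpret bounded_linear "H (z + \<sigma> *\<^sub>R h + s *\<^sub>R k)"
      using g[OF m] by (rule has_derivative_bounded_linear)
    have "((\<lambda>s. z + \<sigma> *\<^sub>R h + s *\<^sub>R k) has_derivative (\<lambda>x. x *\<^sub>R k)) (at s)"
      by (auto intro!: derivative_eq_intros)
    from has_derivative_inner_left[OF has_derivative_compose[OF this g[OF m]]] show ?thesis
      by (simp add: has_field_derivative_def scale mult.commute[of _ "_ \<bullet> _"] mult_commute_abs)
  qed
  from MVT2[OF t this] obtain \<tau> where \<tau>: "0 < \<tau>" "\<tau> < t"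
    and 2: "g (z + \<sigma> *\<^sub>R h + t *\<^sub>R k) \<bullet> h - g (z + \<sigma> *\<^sub>R h) \<bullet> h = t * (H (z + \<sigma> *\<^sub>R h + \<tau> *\<^sub>R k) k \<bullet> h)"
    by auto
  show ?thesis
    using \<sigma> \<tau> 1 2 unfolding \<psi>_def
    by (intro exI[of _ \<sigma>] exI[of _ \<tau>]) (simp add: inner_diff_left power2_eq_square)
qed

text \<open>The second difference over a small parallelogram does not depend on the order of
  \<open>h\<close> and \<open>k\<close>. Computed in both orders by
  \<open>second_difference_mvt\<close>, it yields values of the two mixed derivatives at two points
  near \<open>z\<close>; continuity then excludes a gap at \<open>z\<close>.\<close>

lemma second_derivative_symmetric:
  fixes f :: "'a::euclidean_space \<Rightarrow> real"
  assumes "open S" "z \<in> S"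
    and f: "\<And>z. z \<in> S \<Longrightarrow> (f has_derivative (\<lambda>h. g z \<bullet> h)) (at z)"
    and g: "\<And>z. z \<in> S \<Longrightarrow> (g has_derivative H z) (at z)"
    and H: "\<And>h. continuous_on S (\<lambda>z. H z h)"
  shows "H z h \<bullet> k = h \<bullet> H z k"
proof (rule ccontr)
  let ?e = "\<bar>H z h \<bullet> k - H z k \<bullet> h\<bar> / 2"
  assume "\<not> ?thesis"
  then have e: "?e > 0"
    by (simp add: inner_commute)
  have lim: "((\<lambda>z. H z h \<bullet> k) \<longlongrightarrow> H z h \<bullet> k) (nhds z)" for h k
    using continuous_on_inner[OF H[of h] continuous_on_const[of S k]] \<open>open S\<close> \<open>z \<in> S\<close>
    by (simp add: continuous_on_eq_continuous_at continuous_at tendsto_nhds_iff)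
  obtain d1 where d1: "d1 > 0" "\<And>w. dist w z < d1 \<Longrightarrow> dist (H w h \<bullet> k) (H z h \<bullet> k) < ?e"
    using tendstoD[OF lim e] unfolding eventually_nhds_metric by metis
  obtain d2 where d2: "d2 > 0" "\<And>w. dist w z < d2 \<Longrightarrow> dist (H w k \<bullet> h) (H z k \<bullet> h) < ?e"
    using tendstoD[OF lim e] unfolding eventually_nhds_metric by metis
  obtain d3 where d3: "d3 > 0" "ball z d3 \<subseteq> S"
    using \<open>open S\<close> \<open>z \<in> S\<close> open_contains_ball by blast
  define d where "d = min d1 (min d2 d3)"
  \<comment> \<open>Keeps the parallelogram within distance \<open>d / 2\<close> of
    \<open>z\<close>; the added 1 avoids a zero denominator when \<open>h\<close> and
    \<open>k\<close> vanish.\<close>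
  define t where "t = (d / 2) / (norm h + norm k + 1)"
  have d0: "d > 0" using d1 d2 d3 by (simp add: d_def)
  have np: "norm h + norm k + 1 > 0"
    by (smt (verit) norm_ge_zero)
  then have t: "t > 0" using d0 by (simp add: t_def)
  have near: "dist (z + \<sigma> *\<^sub>R h + \<tau> *\<^sub>R k) z < d" if "0 \<le> \<sigma>" "\<sigma> \<le> t" "0 \<le> \<tau>" "\<tau> \<le> t" for \<sigma> \<tau>
  proof -
    have "dist (z + \<sigma> *\<^sub>R h + \<tau> *\<^sub>R k) z \<le> \<sigma> * norm h + \<tau> * norm k"
      using norm_triangle_ineq[of "\<sigma> *\<^sub>R h" "\<tau> *\<^sub>R k"] that
      by (simp add: dist_norm algebra_simps)
    also have "\<dots> \<le> t * norm h + t * norm k"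
      using that by (intro add_mono mult_right_mono) auto
    also have "\<dots> \<le> t * (norm h + norm k + 1)"
      using t by (simp add: algebra_simps)
    also have "\<dots> = d / 2"
      using np unfolding t_def by (intro nonzero_eq_divide_eq[THEN iffD1]) auto
    also have "\<dots> < d" using d0 by simp
    finally show ?thesis .
  qed
  have inS: "z + \<sigma> *\<^sub>R h + \<tau> *\<^sub>R k \<in> S" if "0 \<le> \<sigma>" "\<sigma> \<le> t" "0 \<le> \<tau>" "\<tau> \<le> t" for \<sigma> \<tau>
    using near[OF that] d3 by (auto simp: d_def dist_commute)
  have inS': "z + \<sigma> *\<^sub>R k + \<tau> *\<^sub>R h \<in> S" if "0 \<le> \<sigma>" "\<sigma> \<le> t" "0 \<le> \<tau>" "\<tau> \<le> t" for \<sigma> \<tau>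
    using inS[of \<tau> \<sigma>] that by (simp add: add_ac)
  obtain \<sigma> \<tau> where 1: "0 \<le> \<sigma>" "\<sigma> \<le> t" "0 \<le> \<tau>" "\<tau> \<le> t"
      "f (z + t *\<^sub>R h + t *\<^sub>R k) - f (z + t *\<^sub>R h) - f (z + t *\<^sub>R k) + f z
      = t\<^sup>2 * (H (z + \<sigma> *\<^sub>R h + \<tau> *\<^sub>R k) k \<bullet> h)"
    using second_difference_mvt[of S f g H, OF f g inS t] by auto
  obtain \<sigma>' \<tau>' where 2: "0 \<le> \<sigma>'" "\<sigma>' \<le> t" "0 \<le> \<tau>'" "\<tau>' \<le> t"
      "f (z + t *\<^sub>R k + t *\<^sub>R h) - f (z + t *\<^sub>R k) - f (z + t *\<^sub>R h) + f z
      = t\<^sup>2 * (H (z + \<sigma>' *\<^sub>R k + \<tau>' *\<^sub>R h) h \<bullet> k)"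
    using second_difference_mvt[of S f g H, OF f g inS' t] by auto
  define a b where "a = z + \<sigma> *\<^sub>R h + \<tau> *\<^sub>R k" and "b = z + \<tau>' *\<^sub>R h + \<sigma>' *\<^sub>R k"
  have "H a k \<bullet> h = H b h \<bullet> k"
    using 1(5) 2(5) t by (simp add: a_def b_def algebra_simps)
  moreover have "dist a z < d" "dist b z < d"
    unfolding a_def b_def using near 1 2 by auto
  then have "dist (H a k \<bullet> h) (H z k \<bullet> h) < ?e" "dist (H b h \<bullet> k) (H z h \<bullet> k) < ?e"
    using d1 d2 by (auto simp: d_def)
  ultimately show False
    by (simp add: dist_real_def abs_if split: if_splits)
qed

lemma C2_on_imp_hessian_symmetric:
  assumes "open S" "C2_on S f" "z \<in> S"
  shows "(hessian f z *v h) \<bullet> k = h \<bullet> (hessian f z *v k)"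
proof -
  have "continuous_on S (\<lambda>z. hessian f z *v h)" for h
    unfolding matrix_vector_mult_def using C2_on_imp_continuous_on_hessian[OF assms(2)]
    by (intro continuous_intros continuous_on_vec_lambda)
  then show ?thesis
    using second_derivative_symmetric[OF assms(1,3), of f "gradient f" "\<lambda>z h. hessian f z *v h"]
      C2_on_imp_has_derivative[OF assms(2)] C2_on_imp_gradient_has_derivative[OF assms(2)]
    by blast
qed

section \<open>Straightness of the level curves of the gradient\<close>

text \<open>\<open>(P, Q)\<close> is the gradient and \<open>A\<close>, \<open>B\<close>,
  \<open>C\<close> are the Hessian entries in a frame whose second vector is in the kernel at the
  origin. As \<open>A\<close> is nonzero there, \<open>(P, y)\<close> is a local C1 coordinate
  system. Only the level curve through the origin is wanted, but its neighbours are needed, because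
  the argument differentiates across the levels.\<close>

lemma level_curve_is_segment:
  fixes P Q A B C :: "real \<times> real \<Rightarrow> real"
  assumes "open W" "(0, 0) \<in> W"
    and P: "\<And>z. z \<in> W \<Longrightarrow> (P has_derivative (\<lambda>h. A z * fst h + B z * snd h)) (at z)"
    and Q: "\<And>z. z \<in> W \<Longrightarrow> (Q has_derivative (\<lambda>h. B z * fst h + C z * snd h)) (at z)"
    and contA: "continuous_on W A" and contB: "continuous_on W B"
    and AC: "\<And>z. z \<in> W \<Longrightarrow> A z * C z = (B z)\<^sup>2"
    and A0: "A (0, 0) \<noteq> 0" and B0: "B (0, 0) = 0"
  shows "\<exists>\<delta>>0. \<exists>c d. \<forall>t. \<bar>t\<bar> < \<delta> \<longrightarrow>
    (0, t) \<in> W \<and> P (0, t) = P (0, 0) \<and> Q (0, t) = Q (0, 0) \<and> B (0, t) = 0 \<and> A (0, t) * (c + d * t) = 1"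
proof -
  define F where "F z = (P z, snd z)" for z
  define L where "L z h = (A z * fst h + B z * snd h, snd h)" for z h
  define F' where "F' z = Blinfun (L z)" for z
  have blL: "bounded_linear (L z)" for z
    unfolding L_def[abs_def] by (intro bounded_linear_intros)
  then have F'_apply: "blinfun_apply (F' z) = L z" for z
    by (simp add: F'_def bounded_linear_Blinfun_apply)
  have derF: "(F has_derivative blinfun_apply (F' z)) (at z)" if "z \<in> W" for z
    unfolding F_def[abs_def] F'_apply L_def
    by (intro has_derivative_Pair P that has_derivative_snd has_derivative_ident)
  have contF': "continuous_on W F'"
  proof (rule continuous_on_blinfun_componentwise)
    show "continuous_on W (\<lambda>z. blinfun_apply (F' z) i)" if "i \<in> Basis" for i
      unfolding F'_apply L_def using contA contB by (intro continuous_intros)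
  qed
  \<comment> \<open>The inverse of the derivative of \<open>F\<close> at the origin, which is
    diagonal because \<open>B (0, 0) = 0\<close>.\<close>
  define K where "K h = (inverse (A (0, 0)) * fst h, snd h)" for h :: "real \<times> real"
  have blK: "bounded_linear K"
    unfolding K_def[abs_def] by (intro bounded_linear_intros)
  have "Blinfun K o\<^sub>L F' (0, 0) = id_blinfun"
    using A0 B0
    by (intro blinfun_eqI) (simp add: bounded_linear_Blinfun_apply[OF blK] F'_apply, simp add: K_def L_def prod_eq_iff)
  from inverse_function_theorem[OF \<open>open W\<close> derF contF' \<open>(0, 0) \<in> W\<close> this]
  obtain U V G G' where U: "open U" "U \<subseteq> W" "(0, 0) \<in> U" and V: "open V" "F (0, 0) \<in> V"
    and hom: "homeomorphism U V F G"
    and G: "\<And>y. y \<in> V \<Longrightarrow> (G has_derivative G' y) (at y)"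
    and G': "\<And>y. y \<in> V \<Longrightarrow> G' y = inv (blinfun_apply (F' (G y)))"
    and bij: "\<And>y. y \<in> V \<Longrightarrow> bij (blinfun_apply (F' (G y)))"
    by metis
  have GU: "G y \<in> U" and FG: "F (G y) = y" if "y \<in> V" for y
    using hom that by (auto simp: homeomorphism_def)
  have GF: "G (F z) = z" if "z \<in> U" for z
    using hom that by (auto simp: homeomorphism_def)
  have GW: "G y \<in> W" if "y \<in> V" for y
    using GU U that by blast
  have A_nz: "A (G y) \<noteq> 0" if "y \<in> V" for y
  proof
    assume "A (G y) = 0"
    then have "L (G y) (1, 0) = L (G y) (0, 0)"
      by (simp add: L_def)
    then show False
      using injD[OF bij_is_inj[OF bij[OF that]], of "(1, 0)" "(0, 0)"] by (simp add: F'_apply)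
  qed
  have G'_eq: "G' y h = ((fst h - B (G y) * snd h) / A (G y), snd h)" if "y \<in> V" for y h
  proof -
    have "L (G y) ((fst h - B (G y) * snd h) / A (G y), snd h) = h"
      using A_nz[OF that] by (simp add: L_def prod_eq_iff)
    then show ?thesis
      using bij[OF that] unfolding G'[OF that] F'_apply by (metis bij_inv_eq_iff)
  qed
  define s0 where "s0 = P (0, 0)"
  have "(s0, 0) \<in> V"
    using V by (simp add: F_def s0_def)
  then obtain \<epsilon>1 where \<epsilon>1: "\<epsilon>1 > 0" "ball (s0, 0) \<epsilon>1 \<subseteq> V"
    using \<open>open V\<close> open_contains_ball by blast
  define \<epsilon> where "\<epsilon> = \<epsilon>1 / 2"
  have \<epsilon>: "\<epsilon> > 0" using \<epsilon>1 by (simp add: \<epsilon>_def)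
  have box: "(s, y) \<in> V" if "\<bar>s - s0\<bar> < \<epsilon>" "\<bar>y\<bar> < \<epsilon>" for s y
  proof -
    have "dist (s, y) (s0, 0) \<le> dist s s0 + dist y 0"
      unfolding dist_Pair_Pair by (rule sqrt_sum_squares_le_sum) auto
    also have "\<dots> < \<epsilon>1" using that by (simp add: dist_real_def \<epsilon>_def)
    finally show ?thesis using \<epsilon>1 by (auto simp: dist_commute)
  qed
  define X where "X s y = fst (G (s, y))" for s y
  have G_eq: "G (s, y) = (X s y, y)" if "(s, y) \<in> V" for s y
    using FG[OF that] by (auto simp: F_def X_def prod_eq_iff)
  define m where "m s y = B (G (s, y)) / A (G (s, y))" for s y
  have Gs: "((\<lambda>s. G (s, y)) has_derivative (\<lambda>h. (h / A (G (s, y)), 0))) (at s)"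
    if "(s, y) \<in> V" for s y
  proof -
    have "((\<lambda>s. (s, y)) has_derivative (\<lambda>h. (h, 0))) (at s)"
      by (intro derivative_intros)
    from has_derivative_compose[OF this G[OF that]] show ?thesis
      by (simp add: G'_eq[OF that])
  qed
  have Gy: "((\<lambda>y. G (s, y)) has_derivative (\<lambda>h. (- m s y * h, h))) (at y)"
    if "(s, y) \<in> V" for s y
  proof -
    have "((\<lambda>y. (s, y)) has_derivative (\<lambda>h. (0, h))) (at y)"
      by (intro derivative_intros)
    from has_derivative_compose[OF this G[OF that]] show ?thesis
      by (simp add: G'_eq[OF that] m_def)
  qed
  have Xs: "((\<lambda>s. X s y) has_real_derivative 1 / A (G (s, y))) (at s)" if "(s, y) \<in> V" for s y
    unfolding X_def
    by (rule has_derivative_imp_has_field_derivative[OF has_derivative_fst[OF Gs[OF that]]]) simp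
  have Xy: "((\<lambda>y. X s y) has_real_derivative - m s y) (at y)" if "(s, y) \<in> V" for s y
    unfolding X_def
    by (rule has_derivative_imp_has_field_derivative[OF has_derivative_fst[OF Gy[OF that]]]) simp
  have Qs: "((\<lambda>s. Q (G (s, y))) has_real_derivative m s y) (at s)" if "(s, y) \<in> V" for s y
    by (rule has_derivative_imp_has_field_derivative
        [OF has_derivative_compose[OF Gs[OF that] Q[OF GW[OF that]]]]) (simp add: m_def)
  have Qy: "((\<lambda>y. Q (G (s, y))) has_real_derivative 0) (at y)" if "(s, y) \<in> V" for s y
  proof -
    \<comment> \<open>This is the vanishing determinant divided by \<open>A\<close>. It cancels the
      two terms of the derivative of \<open>Q\<close> along a level curve of
      \<open>P\<close>.\<close>
    have "C (G (s, y)) = B (G (s, y)) * m s y"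
      using AC[OF GW[OF that]] A_nz[OF that]
      by (simp add: m_def field_simps power2_eq_square)
    then show ?thesis
      by (intro has_derivative_imp_has_field_derivative
          [OF has_derivative_compose[OF Gy[OF that] Q[OF GW[OF that]]]]) simp
  qed
  have const_y: "f y = f 0 + D * y"
    if "\<And>y. \<bar>y\<bar> < \<epsilon> \<Longrightarrow> (f has_real_derivative D) (at y)" "\<bar>y\<bar> < \<epsilon>" for f :: "real \<Rightarrow> real" and D y
  proof -
    have "((\<lambda>y. f y - D * y) has_real_derivative 0) (at y within {-\<epsilon><..<\<epsilon>})" if "y \<in> {-\<epsilon><..<\<epsilon>}" for y
    proof -
      have "(f has_real_derivative D) (at y)"
        using that \<open>\<And>y. \<bar>y\<bar> < \<epsilon> \<Longrightarrow> (f has_real_derivative D) (at y)\<close>[of y] by auto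
      from DERIV_diff[OF has_field_derivative_at_within[OF this] DERIV_cmult_Id[of D]] show ?thesis
        by simp
    qed
    then obtain c where "\<And>y. y \<in> {-\<epsilon><..<\<epsilon>} \<Longrightarrow> f y - D * y = c"
      using has_field_derivative_zero_constant[of "{-\<epsilon><..<\<epsilon>}" "\<lambda>y. f y - D * y"] by auto
    from this[of y] this[of 0] show ?thesis
      using that(2) \<epsilon> by (auto simp: abs_less_iff)
  qed
  \<comment> \<open>\<open>Q\<close> is a function of \<open>P\<close> alone, and by symmetry of the Hessian its derivative \<open>B / A\<close> is also
    minus the slope of the level curve; so that slope is constant along the curve.\<close>
  have Q_const: "Q (G (s, y)) = Q (G (s, 0))" if "\<bar>s - s0\<bar> < \<epsilon>" "\<bar>y\<bar> < \<epsilon>" for s y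
    using const_y[OF Qy[OF box[OF that(1)]] that(2)] by simp
  have m_const: "m s y = m s 0" if "\<bar>s - s0\<bar> < \<epsilon>" "\<bar>y\<bar> < \<epsilon>" for s y
  proof -
    have "((\<lambda>s. Q (G (s, 0))) has_real_derivative m s y) (at s)"
      using Qs[OF box[OF that]]
    proof (rule has_field_derivative_transform_within_open)
      show "open {s. \<bar>s - s0\<bar> < \<epsilon>}"
        by (intro open_Collect_less continuous_intros)
      show "Q (G (s, y)) = Q (G (s, 0))" if "s \<in> {s. \<bar>s - s0\<bar> < \<epsilon>}" for s
        using Q_const[OF _ \<open>\<bar>y\<bar> < \<epsilon>\<close>, of s] that by simp
    qed (use that in simp)
    moreover have "((\<lambda>s. Q (G (s, 0))) has_real_derivative m s 0) (at s)"
      using Qs[OF box[of s 0]] that \<epsilon> by simp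
    ultimately show ?thesis
      by (rule DERIV_unique)
  qed
  have X_affine: "X s y = X s 0 - m s 0 * y" if "\<bar>s - s0\<bar> < \<epsilon>" "\<bar>y\<bar> < \<epsilon>" for s y
  proof -
    have "(X s has_real_derivative - m s 0) (at y)" if "\<bar>y\<bar> < \<epsilon>" for y
      using Xy[OF box[OF \<open>\<bar>s - s0\<bar> < \<epsilon>\<close> that]] m_const[OF \<open>\<bar>s - s0\<bar> < \<epsilon>\<close> that] by simp
    from const_y[OF this that(2)] show ?thesis
      by simp
  qed
  have G0: "G (s0, 0) = (0, 0)"
    using GF[OF \<open>(0, 0) \<in> U\<close>] by (simp add: F_def s0_def)
  then have m0: "m s0 0 = 0" "X s0 0 = 0"
    by (simp_all add: m_def B0 X_def)
  have G0y: "G (s0, y) = (0, y)" if "\<bar>y\<bar> < \<epsilon>" for y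
    using G_eq[OF box[of s0 y]] X_affine[of s0 y] m0 that \<epsilon> by simp
  \<comment> \<open>\<open>X s y\<close> is affine in \<open>y\<close>, hence so is its derivative \<open>1 / A\<close> in \<open>s\<close>.\<close>
  define y1 where "y1 = \<epsilon> / 2"
  define d where "d = (1 / A (0, y1) - 1 / A (0, 0)) / y1"
  have y1: "y1 > 0" "\<bar>y1\<bar> < \<epsilon>" using \<epsilon> by (auto simp: y1_def)
  have main: "A (0, y) * (1 / A (0, 0) + d * y) = 1" if "\<bar>y\<bar> < \<epsilon>" for y
  proof -
    \<comment> \<open>The affine function is written through its values at 0 and \<open>y1\<close>,
      each differentiable in \<open>s\<close>. The slope \<open>m s 0\<close> is not differentiated
      directly: it is a quotient of second derivatives.\<close>
    have "((\<lambda>s. X s 0 + (X s y1 - X s 0) / y1 * y) has_real_derivative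
        1 / A (0, 0) + (1 / A (0, y1) - 1 / A (0, 0)) / y1 * y) (at s0)"
      using Xs[OF box[of s0 0]] Xs[OF box[of s0 y1]] \<epsilon> y1 G0y[of y1] G0
      by (intro DERIV_add DERIV_cmult_right DERIV_cdivide DERIV_diff) auto
    then have "((\<lambda>s. X s y) has_real_derivative 1 / A (0, 0) + d * y) (at s0)"
      unfolding d_def
    proof (rule has_field_derivative_transform_within_open)
      show "open {s. \<bar>s - s0\<bar> < \<epsilon>}"
        by (intro open_Collect_less continuous_intros)
      show "X s 0 + (X s y1 - X s 0) / y1 * y = X s y" if "s \<in> {s. \<bar>s - s0\<bar> < \<epsilon>}" for s
        using X_affine[of s y] X_affine[of s y1] that y1 \<open>\<bar>y\<bar> < \<epsilon>\<close> by simp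
    qed (use \<epsilon> in auto)
    moreover have "((\<lambda>s. X s y) has_real_derivative 1 / A (0, y)) (at s0)"
      using Xs[OF box[of s0 y]] G0y[OF that] that \<epsilon> by simp
    ultimately have "1 / A (0, 0) + d * y = 1 / A (0, y)"
      by (rule DERIV_unique)
    then show ?thesis
      using A_nz[OF box[of s0 y]] G0y[OF that] that \<epsilon> by simp
  qed
  have "(0, y) \<in> W \<and> P (0, y) = P (0, 0) \<and> Q (0, y) = Q (0, 0) \<and> B (0, y) = 0" if "\<bar>y\<bar> < \<epsilon>" for y
  proof (intro conjI)
    have V: "(s0, y) \<in> V"
      using box[of s0 y] that \<epsilon> by simp
    show "(0, y) \<in> W"
      using GW[OF V] G0y[OF that] by simp
    show "P (0, y) = P (0, 0)"
      using FG[OF V] G0y[OF that] by (simp add: F_def s0_def)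
    show "Q (0, y) = Q (0, 0)"
      using Q_const[of s0 y] G0y[OF that] G0 that \<epsilon> by simp
    show "B (0, y) = 0"
      using m_const[of s0 y] m0 G0y[OF that] A_nz[OF V] that \<epsilon> by (simp add: m_def G0 B0)
  qed
  with main \<epsilon> show ?thesis
    by blast
qed

section \<open>Frames, lines and kernels in the plane\<close>

lemma orthonormal_basis_inner:
  assumes "orthonormal_basis e1 e2"
  shows "e1 \<bullet> e1 = 1" "e2 \<bullet> e2 = 1" "e1 \<bullet> e2 = 0" "e2 \<bullet> e1 = 0"
  using assms by (auto simp: orthonormal_basis_def orthogonal_def norm_eq_1 inner_commute)

lemma orthonormal_basis_expansion:
  assumes "orthonormal_basis e1 e2"
  shows "z = (e1 \<bullet> z) *\<^sub>R e1 + (e2 \<bullet> z) *\<^sub>R e2"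
proof (rule ccontr)
  assume neq: "\<not> ?thesis"
  define w where "w = z - (e1 \<bullet> z) *\<^sub>R e1 - (e2 \<bullet> z) *\<^sub>R e2"
  note e = orthonormal_basis_inner[OF assms]
  have w: "e1 \<bullet> w = 0" "e2 \<bullet> w = 0" "w \<noteq> 0"
    using e neq by (auto simp: w_def inner_diff_right algebra_simps)
  then have "pairwise orthogonal {e1, e2, w}" "0 \<notin> {e1, e2, w}"
    using e by (auto simp: pairwise_def orthogonal_def inner_commute)
  then have "independent {e1, e2, w}"
    using pairwise_orthogonal_independent by blast
  then have "card {e1, e2, w} \<le> 2"
    using independent_bound by fastforce
  moreover have "e1 \<noteq> e2" "w \<noteq> e1" "w \<noteq> e2"
    using e w by auto
  ultimately show False
    by auto
qed

lemma orthonormal_basis_exists: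
  assumes "norm e2 = 1"
  obtains e1 where "orthonormal_basis e1 e2"
proof
  show "orthonormal_basis (vector [- e2 $ 2, e2 $ 1]) e2"
    using assms
    by (simp add: orthonormal_basis_def orthogonal_def norm_eq_1 inner_vec_def sum_2 add.commute)
qed

text \<open>The vectors \<open>e2\<close> and \<open>k\<close> are independent and span the plane.
  This is the form in which every crossing of two kernel lines is refuted.\<close>

lemma matrix_eq_0_if_kernel:
  fixes M :: "real^2^2"
  assumes "orthonormal_basis e1 e2" "M *v e2 = 0" "M *v k = 0" "e1 \<bullet> k \<noteq> 0"
  shows "M = 0"
proof -
  have "M *v k = (e1 \<bullet> k) *\<^sub>R (M *v e1) + (e2 \<bullet> k) *\<^sub>R (M *v e2)"
    by (metis orthonormal_basis_expansion[OF assms(1)] matrix_vector_right_distrib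
        matrix_vector_mult_scaleR)
  then have 1: "M *v e1 = 0"
    using assms by simp
  have "M *v z = 0 *v z" for z
  proof -
    have "M *v z = (e1 \<bullet> z) *\<^sub>R (M *v e1) + (e2 \<bullet> z) *\<^sub>R (M *v e2)"
      by (metis orthonormal_basis_expansion[OF assms(1)] matrix_vector_right_distrib
          matrix_vector_mult_scaleR)
    then show ?thesis
      using 1 assms by simp
  qed
  then show ?thesis
    using matrix_eq by blast
qed

lemma is_line_range:
  assumes "k \<noteq> 0"
  shows "is_line (range (\<lambda>t. p + t *\<^sub>R k))"
proof -
  have "range (\<lambda>t. p + t *\<^sub>R k) = affine hull {p, p + k}"
    by (simp add: affine_hull_2_alt)
  then show ?thesis
    using assms by (simp add: is_line_def aff_dim_affine_hull aff_dim_2)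
qed

lemma is_line_direction:
  assumes "is_line L" "p \<in> L"
  obtains k where "norm k = 1" "L = range (\<lambda>t. p + t *\<^sub>R k)"
proof -
  have L: "affine L" "aff_dim L = 1"
    using assms by (auto simp: is_line_def)
  then have "L \<noteq> {p}"
    by force
  then obtain q where q: "q \<in> L" "q \<noteq> p"
    using assms by blast
  then have "affine hull {p, q} = affine hull L"
    using aff_dim_eq_full_gen[of "{p, q}" L] assms(2) L by (simp add: aff_dim_2)
  then have Leq: "L = range (\<lambda>t. p + t *\<^sub>R (q - p))"
    using L by (simp add: affine_hull_2_alt affine_hull_eq[THEN iffD2])
  define k where "k = (q - p) /\<^sub>R norm (q - p)"
  have "p + t *\<^sub>R (q - p) = p + (t * norm (q - p)) *\<^sub>R k"
    "p + t *\<^sub>R k = p + (t / norm (q - p)) *\<^sub>R (q - p)" for t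
    using q by (simp_all add: k_def divide_inverse)
  then have "L = range (\<lambda>t. p + t *\<^sub>R k)"
    unfolding Leq by (metis (no_types, lifting) rangeI image_subset_iff subset_antisym)
  moreover have "norm k = 1"
    using q by (simp add: k_def)
  ultimately show ?thesis
    using that by blast
qed

lemma affine_eq_if_eq_at_two:
  fixes c d c' d' a b :: real
  assumes "c + d * a = c' + d' * a" "c + d * b = c' + d' * b" "a \<noteq> b"
  shows "c = c' \<and> d = d'"
proof -
  have "(d - d') * (a - b) = 0"
    using assms by (simp add: algebra_simps)
  then show ?thesis
    using assms by auto
qed

section \<open>Propagation of the Hessian kernel along straight lines\<close>

locale degenerate_solution =
  fixes \<Omega> :: "(real^2) set" and u :: "real^2 \<Rightarrow> real"
  assumes open_dom: "open \<Omega>"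
    and C2: "C2_on \<Omega> u"
    and monge_ampere: "degenerate_monge_ampere_on \<Omega> u"
begin

abbreviation "g \<equiv> gradient u"
abbreviation "H \<equiv> hessian u"
abbreviation "N \<equiv> nonflat_set \<Omega> u"

lemmas u_has_derivative = C2_on_imp_has_derivative[OF C2]
lemmas g_has_derivative = C2_on_imp_gradient_has_derivative[OF C2]
lemmas H_symmetric = C2_on_imp_hessian_symmetric[OF open_dom C2]

lemma continuous_on_g: "continuous_on \<Omega> g"
  using g_has_derivative
  by (meson continuous_at_imp_continuous_on has_derivative_continuous)

lemma continuous_on_H_mult: "continuous_on \<Omega> (\<lambda>z. H z *v h)"
  unfolding matrix_vector_mult_def using C2_on_imp_continuous_on_hessian[OF C2]
  by (intro continuous_intros continuous_on_vec_lambda)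

text \<open>The equation contains the square of the entry (1, 2), not its product with the entry (2,
  1). Symmetry of the Hessian turns it into a vanishing determinant.\<close>

lemma kernel_exists:
  assumes "z \<in> \<Omega>"
  obtains k where "norm k = 1" "H z *v k = 0"
proof -
  have "H z $ 1 $ 2 = H z $ 2 $ 1"
    using H_symmetric[OF assms, of "axis 2 1" "axis 1 1"]
    by (simp add: inner_axis inner_axis' matrix_vector_mult_basis column_def)
  then have "det (H z) = 0"
    using monge_ampere assms
    by (simp add: degenerate_monge_ampere_on_def det_2 power2_eq_square)
  then have "\<not> (\<exists>B. B ** H z = mat 1)"
    using invertible_det_nz[of "H z"] invertible_left_inverse[of "H z"] by simp
  then obtain k where "H z *v k = 0" "k \<noteq> 0"
    unfolding matrix_left_invertible_ker by blast
  then show ?thesis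
    using that[of "k /\<^sub>R norm k"] by (simp add: matrix_vector_mult_scaleR)
qed

text \<open>Transfers the equation from the standard axes to any orthonormal frame. The coordinates
  \<open>a\<close>, \<open>b\<close> of a unit kernel vector give two linear relations between the
  entries, by which \<open>a\<close> and \<open>b\<close> each annihilate the determinant; they are
  not both zero.\<close>

lemma hessian_entries_degenerate:
  assumes "z \<in> \<Omega>" "orthonormal_basis e1 e2"
  shows "(e1 \<bullet> (H z *v e1)) * (e2 \<bullet> (H z *v e2)) = (e1 \<bullet> (H z *v e2))\<^sup>2"
proof -
  obtain k where k: "norm k = 1" "H z *v k = 0"
    using kernel_exists assms by blast
  define a b where "a = e1 \<bullet> k" and "b = e2 \<bullet> k"
  have keq: "k = a *\<^sub>R e1 + b *\<^sub>R e2"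
    unfolding a_def b_def using orthonormal_basis_expansion[OF assms(2)] .
  have "a *\<^sub>R (H z *v e1) + b *\<^sub>R (H z *v e2) = 0"
    using k(2) unfolding keq by (simp add: matrix_vector_right_distrib matrix_vector_mult_scaleR)
  then have "e1 \<bullet> (a *\<^sub>R (H z *v e1) + b *\<^sub>R (H z *v e2)) = 0"
      "e2 \<bullet> (a *\<^sub>R (H z *v e1) + b *\<^sub>R (H z *v e2)) = 0"
    by simp_all
  moreover have "e2 \<bullet> (H z *v e1) = e1 \<bullet> (H z *v e2)"
    using H_symmetric[OF assms(1), of e1 e2] by (simp add: inner_commute)
  ultimately have eqs: "a * (e1 \<bullet> (H z *v e1)) + b * (e1 \<bullet> (H z *v e2)) = 0"
      "a * (e1 \<bullet> (H z *v e2)) + b * (e2 \<bullet> (H z *v e2)) = 0"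
    by (simp_all add: inner_add_right)
  have "a \<noteq> 0 \<or> b \<noteq> 0"
    using k(1) keq by auto
  moreover have "a * ((e1 \<bullet> (H z *v e1)) * (e2 \<bullet> (H z *v e2)) - (e1 \<bullet> (H z *v e2))\<^sup>2) = 0"
    "b * ((e1 \<bullet> (H z *v e1)) * (e2 \<bullet> (H z *v e2)) - (e1 \<bullet> (H z *v e2))\<^sup>2) = 0"
    using eqs by algebra+
  ultimately show ?thesis
    by auto
qed

text \<open>\<open>level_curve_is_segment\<close> in the coordinates of the frame at
  \<open>z\<close>. Its condition on \<open>A\<close> holds because otherwise \<open>e1\<close>
  would join \<open>e2\<close> in the kernel and the Hessian at \<open>z\<close> would be
  zero.\<close>

lemma kernel_direction_local:
  assumes z: "z \<in> N" and e: "orthonormal_basis e1 e2" and k: "H z *v e2 = 0"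
  shows "\<exists>\<delta>>0. \<exists>c d. \<forall>t. \<bar>t\<bar> < \<delta> \<longrightarrow> z + t *\<^sub>R e2 \<in> \<Omega> \<and> g (z + t *\<^sub>R e2) = g z \<and>
    H (z + t *\<^sub>R e2) *v e2 = 0 \<and> (e1 \<bullet> (H (z + t *\<^sub>R e2) *v e1)) * (c + d * t) = 1"
proof -
  define \<psi> where "\<psi> w = z + fst w *\<^sub>R e1 + snd w *\<^sub>R e2" for w
  define W where "W = \<psi> -` \<Omega>"
  define P where "P w = e1 \<bullet> g (\<psi> w)" for w
  define Q where "Q w = e2 \<bullet> g (\<psi> w)" for w
  define A where "A w = e1 \<bullet> (H (\<psi> w) *v e1)" for w
  define B where "B w = e1 \<bullet> (H (\<psi> w) *v e2)" for w
  define C where "C w = e2 \<bullet> (H (\<psi> w) *v e2)" for w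
  have z\<Omega>: "z \<in> \<Omega>" and Hz: "H z \<noteq> 0"
    using z by (auto simp: nonflat_set_def)
  have cont\<psi>: "continuous_on S \<psi>" for S
    unfolding \<psi>_def[abs_def] by (intro continuous_intros)
  have W: "w \<in> W \<longleftrightarrow> \<psi> w \<in> \<Omega>" for w
    by (simp add: W_def)
  have \<psi>0: "\<psi> (0, t) = z + t *\<^sub>R e2" for t
    by (simp add: \<psi>_def)
  have sym: "e2 \<bullet> (H (\<psi> w) *v e1) = B w" if "w \<in> W" for w
    using H_symmetric[of "\<psi> w" e1 e2] that by (simp add: B_def W inner_commute)
  have der: "((\<lambda>w. g (\<psi> w)) has_derivative
      (\<lambda>h. fst h *\<^sub>R (H (\<psi> w) *v e1) + snd h *\<^sub>R (H (\<psi> w) *v e2))) (at w)" if "w \<in> W" for w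
  proof -
    have "(\<psi> has_derivative (\<lambda>h. fst h *\<^sub>R e1 + snd h *\<^sub>R e2)) (at w)"
      unfolding \<psi>_def[abs_def] by (auto intro!: derivative_eq_intros)
    from has_derivative_compose[OF this g_has_derivative] that show ?thesis
      by (simp add: W matrix_vector_right_distrib matrix_vector_mult_scaleR)
  qed
  have "\<exists>\<delta>>0. \<exists>c d. \<forall>t. \<bar>t\<bar> < \<delta> \<longrightarrow> (0, t) \<in> W \<and>
    P (0, t) = P (0, 0) \<and> Q (0, t) = Q (0, 0) \<and> B (0, t) = 0 \<and> A (0, t) * (c + d * t) = 1"
  proof (rule level_curve_is_segment)
    show "open W"
      unfolding W_def using open_dom cont\<psi> by (simp add: open_vimage)
    show "(0, 0) \<in> W"
      using z\<Omega> by (simp add: W \<psi>_def)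
    show "(P has_derivative (\<lambda>h. A w * fst h + B w * snd h)) (at w)" if "w \<in> W" for w
      using has_derivative_inner_right[OF der[OF that], of e1]
      by (simp add: P_def[abs_def] A_def B_def inner_add_right mult.commute)
    show "(Q has_derivative (\<lambda>h. B w * fst h + C w * snd h)) (at w)" if "w \<in> W" for w
      using has_derivative_inner_right[OF der[OF that], of e2]
      by (simp add: Q_def[abs_def] C_def sym[OF that] inner_add_right mult.commute)
    show "continuous_on W A" "continuous_on W B"
      unfolding A_def B_def
      by (intro continuous_on_inner continuous_on_const
          continuous_on_compose2[OF continuous_on_H_mult cont\<psi>]; force simp: W)+
    show "A w * C w = (B w)\<^sup>2" if "w \<in> W" for w
      using hessian_entries_degenerate[OF _ e] that by (simp add: A_def B_def C_def W)
    show "B (0, 0) = 0"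
      using k by (simp add: B_def \<psi>_def)
    show "A (0, 0) \<noteq> 0"
    proof
      assume A: "A (0, 0) = 0"
      have "e2 \<bullet> (H z *v e1) = 0"
        using H_symmetric[OF z\<Omega>, of e1 e2] k by (simp add: inner_commute)
      with A have "H z *v e1 = 0"
        using orthonormal_basis_expansion[OF e, of "H z *v e1"] by (simp add: A_def \<psi>_def)
      then show False
        using matrix_eq_0_if_kernel[OF e k, of e1] Hz orthonormal_basis_inner[OF e] by simp
    qed
  qed
  then obtain \<delta> c d where "\<delta> > 0" and *: "\<And>t. \<bar>t\<bar> < \<delta> \<Longrightarrow> (0, t) \<in> W \<and>
    P (0, t) = P (0, 0) \<and> Q (0, t) = Q (0, 0) \<and> B (0, t) = 0 \<and> A (0, t) * (c + d * t) = 1"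
    by blast
  have "z + t *\<^sub>R e2 \<in> \<Omega> \<and> g (z + t *\<^sub>R e2) = g z \<and>
    H (z + t *\<^sub>R e2) *v e2 = 0 \<and> (e1 \<bullet> (H (z + t *\<^sub>R e2) *v e1)) * (c + d * t) = 1"
    if "\<bar>t\<bar> < \<delta>" for t
  proof (intro conjI)
    note t = *[OF that]
    show \<Omega>: "z + t *\<^sub>R e2 \<in> \<Omega>"
      using t by (simp add: W \<psi>0)
    show "(e1 \<bullet> (H (z + t *\<^sub>R e2) *v e1)) * (c + d * t) = 1"
      using t by (simp add: A_def \<psi>0)
    have "e1 \<bullet> g (z + t *\<^sub>R e2) = e1 \<bullet> g z" "e2 \<bullet> g (z + t *\<^sub>R e2) = e2 \<bullet> g z"
      using t \<psi>0[of 0] by (auto simp: P_def Q_def \<psi>0)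
    then show "g (z + t *\<^sub>R e2) = g z"
      using orthonormal_basis_expansion[OF e, of "g z"]
        orthonormal_basis_expansion[OF e, of "g (z + t *\<^sub>R e2)"] by simp
    have "A (0, t) \<noteq> 0" "A (0, t) * C (0, t) = (B (0, t))\<^sup>2"
      using t hessian_entries_degenerate[OF \<Omega> e] by (auto simp: A_def B_def C_def \<psi>0)
    then have "C (0, t) = 0" "B (0, t) = 0"
      using t by auto
    then show "H (z + t *\<^sub>R e2) *v e2 = 0"
      using orthonormal_basis_expansion[OF e, of "H (z + t *\<^sub>R e2) *v e2"]
      by (simp add: B_def C_def \<psi>0)
  qed
  then show ?thesis
    using \<open>\<delta> > 0\<close> by blast
qed

text \<open>An open-and-closed argument on the parameter set \<open>J\<close>. Allowing any
  connected \<open>J\<close> covers both whole components of a line in the domain and bounded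
  segments towards another line.\<close>

proposition hartman_nirenberg:
  assumes z: "z \<in> N" and e: "orthonormal_basis e1 e2" and k: "H z *v e2 = 0"
    and J: "connected J" "0 \<in> J" "\<And>t. t \<in> J \<Longrightarrow> z + t *\<^sub>R e2 \<in> \<Omega>"
    and t: "t \<in> J"
  shows "z + t *\<^sub>R e2 \<in> N \<and> g (z + t *\<^sub>R e2) = g z \<and> H (z + t *\<^sub>R e2) *v e2 = 0"
proof -
  define \<phi> where "\<phi> t = e1 \<bullet> (H (z + t *\<^sub>R e2) *v e1)" for t
  obtain \<delta> c d where "\<delta> > 0" and loc: "\<And>t. \<bar>t\<bar> < \<delta> \<Longrightarrow> g (z + t *\<^sub>R e2) = g z \<and>
    H (z + t *\<^sub>R e2) *v e2 = 0 \<and> \<phi> t * (c + d * t) = 1"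
    using kernel_direction_local[OF z e k] unfolding \<phi>_def by blast
  \<comment> \<open>The affine function \<open>c + d t\<close> is kept fixed: at a limit point the equation for \<open>\<phi>\<close> then shows
    that \<open>\<phi>\<close> has not vanished.\<close>
  define good where "good t \<longleftrightarrow> g (z + t *\<^sub>R e2) = g z \<and>
    H (z + t *\<^sub>R e2) *v e2 = 0 \<and> \<phi> t * (c + d * t) = 1" for t
  \<comment> \<open>Asking for \<open>good\<close> on a whole neighbourhood makes \<open>G\<close>
    open at once; the work lies in closedness.\<close>
  define G where "G = {t \<in> J. \<forall>\<^sub>F s in nhds t. good s}"
  have "open {t. \<forall>\<^sub>F s in nhds t. good s}"
    by (subst open_subopen) (auto simp: eventually_nhds)
  then have "openin (top_of_set J) G"
    unfolding G_def by (auto simp: openin_open)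
  moreover have "closedin (top_of_set J) G"
  proof -
    have cont: "continuous_on J (\<lambda>t. z + t *\<^sub>R e2)"
      by (intro continuous_intros)
    have c1: "continuous_on J (\<lambda>t. g (z + t *\<^sub>R e2))"
      by (rule continuous_on_compose2[OF continuous_on_g cont]) (use J in auto)
    have c2: "continuous_on J (\<lambda>t. H (z + t *\<^sub>R e2) *v h)" for h
      by (rule continuous_on_compose2[OF continuous_on_H_mult cont]) (use J in auto)
    have c3: "continuous_on J (\<lambda>t. \<phi> t * (c + d * t))"
      unfolding \<phi>_def by (intro continuous_intros c2)
    have "closedin (top_of_set J) ({t \<in> J. g (z + t *\<^sub>R e2) = g z} \<inter>
        ({t \<in> J. H (z + t *\<^sub>R e2) *v e2 = 0} \<inter> {t \<in> J. \<phi> t * (c + d * t) = 1}))"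
      by (intro closedin_Int continuous_closedin_preimage_constant c1 c2 c3)
    moreover have "{t \<in> J. g (z + t *\<^sub>R e2) = g z} \<inter>
        ({t \<in> J. H (z + t *\<^sub>R e2) *v e2 = 0} \<inter> {t \<in> J. \<phi> t * (c + d * t) = 1}) = {t \<in> J. good t}"
      by (auto simp: good_def)
    ultimately obtain K where K: "closed K" "{t \<in> J. good t} = J \<inter> K"
      by (auto simp: closedin_closed)
    have GK: "G \<subseteq> {t \<in> J. good t}"
      by (auto simp: G_def dest: eventually_nhds_x_imp_x)
    have "t \<in> G" if t: "t \<in> J" "t \<in> closure G" for t
    proof -
      have "good t"
        using t K GK by (metis (no_types, lifting) Int_iff closure_minimal le_inf_iff mem_Collect_eq subsetD)
      then have "z + t *\<^sub>R e2 \<in> N" and kt: "H (z + t *\<^sub>R e2) *v e2 = 0"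
        using J t by (auto simp: nonflat_set_def good_def \<phi>_def)
      from kernel_direction_local[OF this(1) e kt]
      obtain \<eta> c' d' where \<eta>: "\<eta> > 0" and loc': "\<And>s. \<bar>s\<bar> < \<eta> \<Longrightarrow>
          g (z + t *\<^sub>R e2 + s *\<^sub>R e2) = g (z + t *\<^sub>R e2) \<and>
          H (z + t *\<^sub>R e2 + s *\<^sub>R e2) *v e2 = 0 \<and>
          (e1 \<bullet> (H (z + t *\<^sub>R e2 + s *\<^sub>R e2) *v e1)) * (c' + d' * s) = 1"
        by blast
      have loc'': "g (z + s *\<^sub>R e2) = g z \<and> H (z + s *\<^sub>R e2) *v e2 = 0 \<and>
          \<phi> s * ((c' - d' * t) + d' * s) = 1" if "\<bar>s - t\<bar> < \<eta>" for s
      proof -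
        have "z + t *\<^sub>R e2 + (s - t) *\<^sub>R e2 = z + s *\<^sub>R e2"
          by (simp add: algebra_simps)
        then show ?thesis
          using loc'[OF that] \<open>good t\<close> by (simp add: good_def \<phi>_def algebra_simps)
      qed
      obtain t1 where t1: "t1 \<in> G" "\<bar>t1 - t\<bar> < \<eta>"
        using t(2) \<eta> by (metis closure_approachable dist_real_def)
      then obtain \<rho> where \<rho>: "\<rho> > 0" and good: "\<And>s. \<bar>s - t1\<bar> < \<rho> \<Longrightarrow> good s"
        by (auto simp: G_def eventually_nhds_metric dist_real_def)
      \<comment> \<open>A second point where the old and the new affine function are both
        reciprocals of \<open>\<phi>\<close>. Agreement at \<open>t1\<close> and \<open>t2\<close>
        identifies them, so \<open>good\<close> extends to the whole neighbourhood of
        \<open>t\<close>.\<close>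
      define t2 where "t2 = t1 + min (\<rho> / 2) ((\<eta> - \<bar>t1 - t\<bar>) / 2)"
      have t2: "t2 \<noteq> t1" "\<bar>t2 - t1\<bar> < \<rho>" "\<bar>t2 - t\<bar> < \<eta>"
        using \<rho> t1 by (auto simp: t2_def min_def abs_if field_simps split: if_splits)
      have "c + d * s = (c' - d' * t) + d' * s" if "\<bar>s - t1\<bar> < \<rho>" "\<bar>s - t\<bar> < \<eta>" for s
        using good[OF that(1)] loc''[OF that(2)] unfolding good_def
        by (metis mult_cancel_left mult_zero_left zero_neq_one)
      from affine_eq_if_eq_at_two[OF this[of t1] this[of t2]]
      have "c = c' - d' * t" "d = d'"
        using t1 t2 \<rho> by auto
      then have "good s" if "\<bar>s - t\<bar> < \<eta>" for s
        using loc''[OF that] by (simp add: good_def)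
      then show ?thesis
        using t \<eta> by (auto simp: G_def eventually_nhds_metric dist_real_def)
    qed
    moreover have "G \<subseteq> closure G" "G \<subseteq> J"
      by (rule closure_subset) (auto simp: G_def)
    ultimately have "G = J \<inter> closure G"
      by blast
    then show ?thesis
      by (metis closed_closure closedin_closed_Int)
  qed
  moreover have "0 \<in> G"
    using J \<open>\<delta> > 0\<close> loc by (auto simp: G_def eventually_nhds_metric dist_real_def good_def)
  ultimately have "G = J"
    using J(1) unfolding connected_clopen by blast
  then have "good t"
    using t by (auto simp: G_def dest: eventually_nhds_x_imp_x)
  then show ?thesis
    using J(3)[OF t] by (auto simp: good_def nonflat_set_def \<phi>_def)
qed

end

section \<open>Twice continuously differentiable functions\<close>

text \<open>\<open>frechet_derivative\<close> chooses from the set of derivatives. Equality of these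
  sets suffices, so differentiability is not assumed.\<close>

lemma partial_deriv_cong_open:
  assumes "open S" "x \<in> S" "\<And>y. y \<in> S \<Longrightarrow> f y = h y"
  shows "partial_deriv b f x = partial_deriv b h x"
proof -
  have "(f has_derivative D) (at x) \<longleftrightarrow> (h has_derivative D) (at x)" for D
    using has_derivative_transform_within_open[OF _ assms(1,2)] assms(3) by metis
  then show ?thesis
    by (simp add: partial_deriv_def frechet_derivative_def)
qed

lemma C1_on_cong_open:
  assumes "open S" "\<And>x. x \<in> S \<Longrightarrow> f x = h x" "C1_on S f"
  shows "C1_on S h"
  unfolding C1_on_def
proof (intro conjI ballI)
  fix x assume x: "x \<in> S"
  then obtain D where "(f has_derivative D) (at x)"
    using assms(3) by (auto simp: C1_on_def differentiable_def)
  then have "(h has_derivative D) (at x)"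
    by (rule has_derivative_transform_within_open[OF _ assms(1) x assms(2)])
  then show "h differentiable (at x)"
    by (auto simp: differentiable_def)
next
  fix b :: 'a assume "b \<in> Basis"
  then have "continuous_on S (partial_deriv b f)"
    using assms(3) by (simp add: C1_on_def)
  then show "continuous_on S (partial_deriv b h)"
    by (rule continuous_on_eq) (rule partial_deriv_cong_open[OF assms(1) _ assms(2)])
qed

lemma C2_on_cong_open:
  assumes "open S" "\<And>x. x \<in> S \<Longrightarrow> f x = h x" "C2_on S f"
  shows "C2_on S h"
  unfolding C2_on_def
proof (intro conjI ballI)
  show "C1_on S h"
    using assms C1_on_cong_open unfolding C2_on_def by blast
  fix b :: 'a assume "b \<in> Basis"
  then have "C1_on S (partial_deriv b f)"
    using assms(3) by (simp add: C2_on_def)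
  then show "C1_on S (partial_deriv b h)"
    by (rule C1_on_cong_open[OF assms(1), rotated]) (rule partial_deriv_cong_open[OF assms(1) _ assms(2)])
qed

lemma C1_on_Un_open:
  assumes "open S" "open T" "C1_on S f" "C1_on T f"
  shows "C1_on (S \<union> T) f"
  using assms unfolding C1_on_def by (auto intro: continuous_on_open_Un)

lemma C2_on_Un_open:
  assumes "open S" "open T" "C2_on S f" "C2_on T f"
  shows "C2_on (S \<union> T) f"
  using assms unfolding C2_on_def by (auto intro: C1_on_Un_open)

text \<open>The equivalence makes the choice in \<open>frechet_derivative\<close> commute with
  translations; hence \<open>partial_deriv_shift\<close> is unconditional.\<close>

lemma has_derivative_shift_iff:
  "((\<lambda>x. f (x + c) + d) has_derivative D) (at x) \<longleftrightarrow> (f has_derivative D) (at (x + c))"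
proof
  assume "(f has_derivative D) (at (x + c))"
  then have "((\<lambda>x. f (x + c)) has_derivative D) (at x)"
    using has_derivative_compose[of "\<lambda>x. x + c" "\<lambda>h. h" x UNIV f D]
    by (simp add: has_derivative_add_const)
  then show "((\<lambda>x. f (x + c) + d) has_derivative D) (at x)"
    by (rule has_derivative_add_const)
next
  let ?F = "\<lambda>x. f (x + c) + d"
  assume "(?F has_derivative D) (at x)"
  then have "((\<lambda>y. ?F (y - c)) has_derivative D) (at (x + c))"
    using has_derivative_compose[of "\<lambda>y. y + - c" "\<lambda>h. h" "x + c" UNIV ?F D]
    by (simp add: has_derivative_add_const del: add_uminus_conv_diff)
  from has_derivative_add_const[OF this, of "- d"] show "(f has_derivative D) (at (x + c))"
    by simp
qed

lemma partial_deriv_shift: "partial_deriv b (\<lambda>x. f (x + c) + d) x = partial_deriv b f (x + c)"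
  by (simp add: partial_deriv_def frechet_derivative_def has_derivative_shift_iff)

lemma C1_on_shift:
  assumes "C1_on T f" "\<And>x. x \<in> S \<Longrightarrow> x + c \<in> T"
  shows "C1_on S (\<lambda>x. f (x + c) + d)"
  unfolding C1_on_def partial_deriv_shift[abs_def]
proof (intro conjI ballI)
  show "(\<lambda>x. f (x + c) + d) differentiable at x" if "x \<in> S" for x
    using assms that by (auto simp: C1_on_def differentiable_def has_derivative_shift_iff)
  show "continuous_on S (\<lambda>x. partial_deriv b f (x + c))" if "b \<in> Basis" for b
  proof (rule continuous_on_compose2[of T])
    show "continuous_on T (partial_deriv b f)"
      using assms that by (simp add: C1_on_def)
  qed (use assms in \<open>auto intro!: continuous_intros\<close>)
qed

lemma C2_on_shift:
  assumes "C2_on T f" "\<And>x. x \<in> S \<Longrightarrow> x + c \<in> T"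
  shows "C2_on S (\<lambda>x. f (x + c) + d)"
  unfolding C2_on_def partial_deriv_shift[abs_def]
proof (intro conjI ballI)
  show "C1_on S (\<lambda>x. f (x + c) + d)"
    using assms C1_on_shift unfolding C2_on_def by blast
  show "C1_on S (\<lambda>x. partial_deriv b f (x + c))" if "b \<in> Basis" for b
    using C1_on_shift[of T "partial_deriv b f" S c 0] assms that unfolding C2_on_def by simp
qed

lemma C2_on_realI:
  fixes \<alpha> \<alpha>1 \<alpha>2 :: "real \<Rightarrow> real"
  assumes "open I"
    and 1: "\<And>x. x \<in> I \<Longrightarrow> (\<alpha> has_real_derivative \<alpha>1 x) (at x)"
    and 2: "\<And>x. x \<in> I \<Longrightarrow> (\<alpha>1 has_real_derivative \<alpha>2 x) (at x)"
    and "continuous_on I \<alpha>2"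
  shows "C2_on I \<alpha>"
proof -
  have C1: "C1_on I f" and pd: "\<And>x. x \<in> I \<Longrightarrow> f' x = partial_deriv 1 f x"
    if "\<And>x. x \<in> I \<Longrightarrow> (f has_real_derivative f' x) (at x)" "continuous_on I f'" for f f' :: "real \<Rightarrow> real"
  proof -
    show eq: "f' x = partial_deriv 1 f x" if "x \<in> I" for x
      using frechet_derivative_at[OF \<open>\<And>x. x \<in> I \<Longrightarrow> (f has_real_derivative f' x) (at x)\<close>
          [OF that, unfolded has_field_derivative_def]]
      by (metis mult.right_neutral partial_deriv_def)
    have "continuous_on I (partial_deriv 1 f)"
      using that(2) by (rule continuous_on_eq) (rule eq)
    moreover have "f differentiable (at x)" if "x \<in> I" for x
      using \<open>\<And>x. x \<in> I \<Longrightarrow> (f has_real_derivative f' x) (at x)\<close>[OF that]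
      by (auto simp: differentiable_def has_field_derivative_def)
    ultimately show "C1_on I f"
      by (simp add: C1_on_def)
  qed
  have c1: "continuous_on I \<alpha>1"
    using 2 by (meson DERIV_isCont continuous_at_imp_continuous_on)
  have "C1_on I (partial_deriv 1 \<alpha>)"
    using C1_on_cong_open[OF \<open>open I\<close> pd[OF 1 c1] C1[OF 2 assms(4)]] .
  then show ?thesis
    using C1[OF 1 c1] by (simp add: C2_on_def)
qed

section \<open>Strips\<close>

lemma strip_eq:
  assumes "orthonormal_basis e1 e2"
  shows "strip e1 e2 I = {z. e1 \<bullet> z \<in> I}"
proof (intro set_eqI iffI)
  show "z \<in> {z. e1 \<bullet> z \<in> I}" if "z \<in> strip e1 e2 I" for z
    using that orthonormal_basis_inner[OF assms] by (auto simp: strip_def inner_add_right)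
  show "z \<in> strip e1 e2 I" if "z \<in> {z. e1 \<bullet> z \<in> I}" for z
    using orthonormal_basis_expansion[OF assms, of z] that unfolding strip_def by blast
qed

lemma line_eq_level_set:
  assumes "orthonormal_basis e1 e2"
  shows "range (\<lambda>t. b + t *\<^sub>R e2) = {z. e1 \<bullet> z = e1 \<bullet> b}"
proof (intro set_eqI iffI)
  show "z \<in> {z. e1 \<bullet> z = e1 \<bullet> b}" if "z \<in> range (\<lambda>t. b + t *\<^sub>R e2)" for z
    using that orthonormal_basis_inner[OF assms] by (auto simp: inner_add_right)
  show "z \<in> range (\<lambda>t. b + t *\<^sub>R e2)" if "z \<in> {z. e1 \<bullet> z = e1 \<bullet> b}" for z
  proof
    show "z = b + (e2 \<bullet> (z - b)) *\<^sub>R e2"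
      using orthonormal_basis_expansion[OF assms, of "z - b"] that
      by (simp add: inner_diff_right algebra_simps)
  qed auto
qed

lemma open_strip_open_convex:
  assumes "open_strip T"
  shows "open T" "convex T"
proof -
  obtain f1 f2 J where f: "orthonormal_basis f1 f2" "open_interval J" "T = strip f1 f2 J"
    using assms by (auto simp: open_strip_def)
  have T: "T = (\<lambda>z. f1 \<bullet> z) -` J"
    using f strip_eq by auto
  show "open T"
    unfolding T using f(2) by (intro open_vimage continuous_intros) (auto simp: open_interval_def)
  show "convex T"
    unfolding T using f(2)
    by (intro convex_linear_vimage) (auto simp: open_interval_def is_interval_convex_1 intro!: bounded_linear.linear bounded_linear_inner_right)
qed

text \<open>If a point \<open>P\<close> of \<open>X\<close> projected between the line and
  \<open>z\<close>, it would lie on a segment from some point of the line to a point of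
  \<open>T\<close>. The line lies wholly in \<open>T\<close>, so convexity would put
  \<open>P\<close> into \<open>T\<close>.\<close>

lemma convex_avoiding_points_within_strip:
  fixes X :: "(real^2) set"
  assumes e: "orthonormal_basis e1 e2" and T: "open T" "convex T" "T \<inter> X = {}"
    and L: "\<And>z. e1 \<bullet> z = x0 \<Longrightarrow> z \<in> T"
    and z: "z \<in> T"
  shows "closed_segment x0 (e1 \<bullet> z) \<inter> (\<lambda>P. e1 \<bullet> P) ` X = {}"
proof (rule ccontr)
  assume "\<not> ?thesis"
  then obtain P where P: "P \<in> X" "e1 \<bullet> P \<in> closed_segment x0 (e1 \<bullet> z)"
    by auto
  then obtain s where s: "0 \<le> s" "s \<le> 1" "e1 \<bullet> P = (1 - s) * x0 + s * (e1 \<bullet> z)"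
    by (auto simp: in_segment)
  define a where "a = x0 *\<^sub>R e1"
  have a: "e1 \<bullet> a = x0"
    using orthonormal_basis_inner[OF e] by (simp add: a_def)
  \<comment> \<open>Moving away from the line inside the open set \<open>T\<close> makes the parameter strictly less than 1.\<close>
  have "((\<lambda>\<epsilon>. z + \<epsilon> *\<^sub>R (z - a)) \<longlongrightarrow> z + 0 *\<^sub>R (z - a)) (at_right 0)"
    by (intro tendsto_intros)
  then have "\<forall>\<^sub>F \<epsilon> in at_right 0. z + \<epsilon> *\<^sub>R (z - a) \<in> T"
    using topological_tendstoD[OF _ T(1)] z by simp
  then have "\<forall>\<^sub>F \<epsilon> in at_right 0. \<epsilon> > 0 \<and> z + \<epsilon> *\<^sub>R (z - a) \<in> T"
    by (intro eventually_conj eventually_at_right_less)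
  then obtain \<epsilon> :: real where \<epsilon>: "\<epsilon> > 0" "z + \<epsilon> *\<^sub>R (z - a) \<in> T"
    using eventually_happens'[OF trivial_limit_at_right_real] by blast
  define z1 where "z1 = z + \<epsilon> *\<^sub>R (z - a)"
  define r where "r = s / (1 + \<epsilon>)"
  have r: "0 \<le> r" "r < 1"
    using s \<epsilon> by (auto simp: r_def)
  have rs: "r * (1 + \<epsilon>) = s"
    using \<epsilon> by (simp add: r_def)
  have "e1 \<bullet> P = (1 - r) * x0 + r * (e1 \<bullet> z1)"
    unfolding s(3) rs[symmetric] by (simp add: z1_def inner_add_right inner_diff_right a algebra_simps)
  \<comment> \<open>Solved from \<open>P = (1 - r) *\<^sub>R w + r *\<^sub>R z1\<close>.\<close>
  define w where "w = (1 / (1 - r)) *\<^sub>R (P - r *\<^sub>R z1)"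
  have "e1 \<bullet> w = x0"
    using r \<open>e1 \<bullet> P = (1 - r) * x0 + r * (e1 \<bullet> z1)\<close>
    by (simp add: w_def inner_diff_right)
  then have "w \<in> T"
    by (rule L)
  moreover have "P = (1 - r) *\<^sub>R w + r *\<^sub>R z1"
    using r by (simp add: w_def)
  ultimately have "P \<in> T"
    using T(2) \<epsilon>(2) r unfolding convex_alt z1_def by auto
  then show False
    using P T by blast
qed

text \<open>The strip over the component contains every competing strip, because competitors are
  open and convex; their own frames need not be compared. A largest competitor is the only maximal
  one, so the definite description is resolved.\<close>

lemma maximal_strip_eq:
  assumes e: "orthonormal_basis e1 e2" and "finite X" and "e1 \<bullet> a \<notin> (\<lambda>P. e1 \<bullet> P) ` X"
  defines "I \<equiv> connected_component_set (- (\<lambda>P. e1 \<bullet> P) ` X) (e1 \<bullet> a)"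
  shows "open_interval I" "maximal_strip (UNIV - X) (range (\<lambda>t. a + t *\<^sub>R e2)) = strip e1 e2 I"
proof -
  let ?L = "range (\<lambda>t. a + t *\<^sub>R e2)"
  have aI: "e1 \<bullet> a \<in> I"
    using assms by (simp add: I_def)
  have "open I"
    unfolding I_def using \<open>finite X\<close>
    by (intro open_connected_component open_Compl finite_imp_closed finite_imageI)
  moreover have "connected I"
    by (simp add: I_def)
  ultimately show I: "open_interval I"
    using aI by (auto simp: open_interval_def is_interval_connected_1)
  have IX: "I \<inter> (\<lambda>P. e1 \<bullet> P) ` X = {}"
    using connected_component_subset unfolding I_def by blast
  have S: "open_strip (strip e1 e2 I)" "?L \<subseteq> strip e1 e2 I" "strip e1 e2 I \<subseteq> UNIV - X"
  proof -
    show "open_strip (strip e1 e2 I)"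
      using e I by (auto simp: open_strip_def)
    show "?L \<subseteq> strip e1 e2 I" "strip e1 e2 I \<subseteq> UNIV - X"
      unfolding line_eq_level_set[OF e] strip_eq[OF e] using aI IX by auto
  qed
  have max: "T \<subseteq> strip e1 e2 I" if T: "open_strip T" "?L \<subseteq> T" "T \<subseteq> UNIV - X" for T
  proof
    fix z assume z: "z \<in> T"
    have "closed_segment (e1 \<bullet> a) (e1 \<bullet> z) \<inter> (\<lambda>P. e1 \<bullet> P) ` X = {}"
      using T z unfolding line_eq_level_set[OF e]
      by (intro convex_avoiding_points_within_strip[OF e open_strip_open_convex[OF T(1)]]) auto
    then have "closed_segment (e1 \<bullet> a) (e1 \<bullet> z) \<subseteq> I"
      unfolding I_def by (intro connected_component_maximal) auto
    then show "z \<in> strip e1 e2 I"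
      by (auto simp: strip_eq[OF e])
  qed
  show "maximal_strip (UNIV - X) ?L = strip e1 e2 I"
    unfolding maximal_strip_def
  proof (rule the_equality)
    show "open_strip (strip e1 e2 I) \<and> ?L \<subseteq> strip e1 e2 I \<and> strip e1 e2 I \<subseteq> UNIV - X \<and>
      (\<forall>T. open_strip T \<and> ?L \<subseteq> T \<and> T \<subseteq> UNIV - X \<and> strip e1 e2 I \<subseteq> T \<longrightarrow> T = strip e1 e2 I)"
      using S max by (meson subset_antisym)
    show "S' = strip e1 e2 I" if "open_strip S' \<and> ?L \<subseteq> S' \<and> S' \<subseteq> UNIV - X \<and>
      (\<forall>T. open_strip T \<and> ?L \<subseteq> T \<and> T \<subseteq> UNIV - X \<and> S' \<subseteq> T \<longrightarrow> T = S')" for S'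
      using that S max[of S'] by metis
  qed
qed

section \<open>Leaves and barriers\<close>

context degenerate_solution
begin

lemma kernel_if_gradient_constant:
  assumes "z \<in> \<Omega>" "\<delta> > 0" and const: "\<And>t. \<bar>t\<bar> < \<delta> \<Longrightarrow> g (z + t *\<^sub>R k) = g z"
  shows "H z *v k = 0"
proof -
  have "((\<lambda>t. z + t *\<^sub>R k) has_derivative (\<lambda>t. t *\<^sub>R k)) (at 0)"
    by (auto intro!: derivative_eq_intros)
  from has_derivative_compose[OF this, of g "\<lambda>h. H z *v h"]
  have "((\<lambda>t. g (z + t *\<^sub>R k)) has_derivative (\<lambda>t. t *\<^sub>R (H z *v k))) (at 0)"
    using g_has_derivative[OF \<open>z \<in> \<Omega>\<close>] by (simp add: matrix_vector_mult_scaleR)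
  then have "((\<lambda>t. g z) has_derivative (\<lambda>t. t *\<^sub>R (H z *v k))) (at 0)"
  proof (rule has_derivative_transform_within_open)
    show "open {t. \<bar>t\<bar> < \<delta>}"
      by (intro open_Collect_less continuous_intros)
  qed (use assms in auto)
  from has_derivative_unique[OF this has_derivative_const] have "1 *\<^sub>R (H z *v k) = 0"
    by metis
  then show ?thesis
    by simp
qed

definition is_leaf_line :: "real^2 \<Rightarrow> (real^2) set \<Rightarrow> bool" where
  "is_leaf_line q L \<longleftrightarrow> is_line L \<and> q \<in> L \<and>
    connected_component_set (L \<inter> \<Omega>) q \<subseteq> N \<and>
    g constant_on connected_component_set (L \<inter> \<Omega>) q"

lemma is_leaf_line_kernel:
  assumes q: "q \<in> N" and L: "is_leaf_line q L" "L = range (\<lambda>t. q + t *\<^sub>R k)"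
  shows "H q *v k = 0"
proof -
  have q\<Omega>: "q \<in> \<Omega>"
    using q by (simp add: nonflat_set_def)
  have "((\<lambda>t. q + t *\<^sub>R k) \<longlongrightarrow> q + 0 *\<^sub>R k) (nhds 0)"
    by (intro tendsto_intros filterlim_ident)
  then have "\<forall>\<^sub>F t in nhds 0. q + t *\<^sub>R k \<in> \<Omega>"
    using topological_tendstoD[OF _ open_dom] q\<Omega> by simp
  then obtain \<delta> where \<delta>: "\<delta> > 0" "\<And>t. \<bar>t\<bar> < \<delta> \<Longrightarrow> q + t *\<^sub>R k \<in> \<Omega>"
    unfolding eventually_nhds_metric dist_real_def by auto
  let ?T = "(\<lambda>t. q + t *\<^sub>R k) ` {-\<delta><..<\<delta>}"
  let ?C = "connected_component_set (L \<inter> \<Omega>) q"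
  have q_eq: "q = q + 0 *\<^sub>R k"
    by simp
  have "q \<in> ?T"
    using \<delta>(1) by (subst q_eq) (intro imageI, simp)
  moreover have "connected ?T"
    by (intro connected_continuous_image continuous_intros) simp
  moreover have "?T \<subseteq> L \<inter> \<Omega>"
    using \<delta>(2) L(2) by auto
  ultimately have "?T \<subseteq> ?C" "q \<in> ?C"
    using connected_component_maximal[of q ?T "L \<inter> \<Omega>"] by auto
  moreover obtain y where "\<And>x. x \<in> ?C \<Longrightarrow> g x = y"
    using L(1) unfolding is_leaf_line_def constant_on_def by blast
  ultimately have "g (q + t *\<^sub>R k) = g q" if "\<bar>t\<bar> < \<delta>" for t
    using that by (auto simp: image_subset_iff abs_less_iff)
  then show ?thesis
    using kernel_if_gradient_constant[OF q\<Omega> \<delta>(1)] by blast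
qed

text \<open>Justifies the definite description in \<open>leaf_line\<close>. Existence is
  \<open>hartman_nirenberg\<close> along a kernel direction; uniqueness holds because the nonzero
  Hessian at \<open>q\<close> has only one kernel direction.\<close>

lemma is_leaf_line_leaf_line:
  assumes q: "q \<in> N"
  shows "is_leaf_line q (leaf_line \<Omega> u q)"
proof -
  have q\<Omega>: "q \<in> \<Omega>" and Hq: "H q \<noteq> 0"
    using q by (auto simp: nonflat_set_def)
  obtain k where k: "norm k = 1" "H q *v k = 0"
    using kernel_exists[OF q\<Omega>] .
  obtain f where f: "orthonormal_basis f k"
    using orthonormal_basis_exists[OF k(1)] .
  define L where "L = range (\<lambda>t. q + t *\<^sub>R k)"
  let ?C = "connected_component_set (L \<inter> \<Omega>) q"
  have qL: "q \<in> L"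
    unfolding L_def by (rule range_eqI[of _ _ 0]) simp
  have C: "z \<in> N \<and> g z = g q" if z: "z \<in> ?C" for z
  proof -
    \<comment> \<open>The parameters of the component on the line; as \<open>k\<close> is a unit
      vector, the inner product recovers them.\<close>
    define J where "J = (\<lambda>z. k \<bullet> (z - q)) ` ?C"
    have sub: "?C \<subseteq> L \<inter> \<Omega>"
      by (rule connected_component_subset)
    have on_line: "q + (k \<bullet> (w - q)) *\<^sub>R k = w" if "w \<in> L" for w
      using that k(1) by (auto simp: L_def norm_eq_1)
    have "connected J"
      unfolding J_def by (intro connected_continuous_image continuous_intros) simp
    moreover have "0 \<in> J"
      unfolding J_def by (rule image_eqI[of _ _ q]) (simp_all add: qL q\<Omega>)
    moreover have "q + t *\<^sub>R k \<in> \<Omega>" if t: "t \<in> J" for t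
    proof -
      obtain w where "w \<in> ?C" "t = k \<bullet> (w - q)"
        using t unfolding J_def by blast
      then show ?thesis
        using sub on_line[of w] by (metis IntE subsetD)
    qed
    moreover have "k \<bullet> (z - q) \<in> J"
      using z by (auto simp: J_def)
    ultimately show ?thesis
      using hartman_nirenberg[OF q f k(2), of J "k \<bullet> (z - q)"] on_line[of z] sub z by auto
  qed
  have "is_line L"
    unfolding L_def using k(1) by (intro is_line_range) auto
  then have "is_leaf_line q L"
    unfolding is_leaf_line_def constant_on_def using qL C by blast
  moreover have "L' = L" if L': "is_leaf_line q L'" for L'
  proof -
    obtain l where l: "norm l = 1" "L' = range (\<lambda>t. q + t *\<^sub>R l)"
      using is_line_direction[of L' q] L' by (auto simp: is_leaf_line_def)
    have "H q *v l = 0"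
      using is_leaf_line_kernel[OF q L' l(2)] .
    then have "f \<bullet> l = 0"
      using matrix_eq_0_if_kernel[OF f k(2)] Hq by blast
    then have l_eq: "l = (k \<bullet> l) *\<^sub>R k"
      using orthonormal_basis_expansion[OF f, of l] by simp
    define c where "c = k \<bullet> l"
    have "c \<noteq> 0"
      using l_eq l(1) by (auto simp: c_def)
    have "range (\<lambda>t. q + t *\<^sub>R l) = range (\<lambda>t. q + t *\<^sub>R k)"
    proof (intro subset_antisym image_subsetI)
      show "q + t *\<^sub>R l \<in> range (\<lambda>t. q + t *\<^sub>R k)" for t
        by (rule range_eqI[of _ _ "t * c"]) (subst l_eq, simp add: c_def)
      show "q + t *\<^sub>R k \<in> range (\<lambda>t. q + t *\<^sub>R l)" for t
        using \<open>c \<noteq> 0\<close> by (intro range_eqI[of _ _ "t / c"]) (subst l_eq, simp add: c_def)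
    qed
    then show ?thesis
      by (simp add: l(2) L_def)
  qed
  ultimately have "\<exists>!L. is_leaf_line q L"
    by blast
  from theI'[OF this] show ?thesis
    by (simp add: leaf_line_def is_leaf_line_def)
qed

lemma leaf_is_line:
  assumes q: "q \<in> N" and line: "is_line (leaf \<Omega> u q)"
  obtains k where "norm k = 1" "leaf \<Omega> u q = range (\<lambda>t. q + t *\<^sub>R k)"
    "leaf \<Omega> u q \<subseteq> N" "\<And>z. z \<in> leaf \<Omega> u q \<Longrightarrow> H z *v k = 0"
proof -
  note L = is_leaf_line_leaf_line[OF q, unfolded is_leaf_line_def, folded leaf_def]
  have "q \<in> leaf \<Omega> u q"
    using L q by (simp add: leaf_def nonflat_set_def)
  from is_line_direction[OF line this]
  obtain k where k: "norm k = 1" "leaf \<Omega> u q = range (\<lambda>t. q + t *\<^sub>R k)" .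
  obtain y where y: "\<And>x. x \<in> leaf \<Omega> u q \<Longrightarrow> g x = y"
    using L unfolding constant_on_def by blast
  have "H z *v k = 0" if z: "z \<in> leaf \<Omega> u q" for z
  proof (rule kernel_if_gradient_constant[where \<delta> = 1])
    show "z \<in> \<Omega>"
      using z L by (auto simp: nonflat_set_def)
    obtain s where s: "z = q + s *\<^sub>R k"
      using z k by auto
    have "z + t *\<^sub>R k \<in> leaf \<Omega> u q" for t
      unfolding k(2) s by (rule range_eqI[of _ _ "s + t"]) (simp add: algebra_simps)
    then show "g (z + t *\<^sub>R k) = g z" for t
      using y z by simp
  qed simp
  then show ?thesis
    using that k L by blast
qed

text \<open>Covers the two kinds of lines that leaves cannot cross: leaves and lines in the flat set.\<close>

definition barrier :: "real^2 \<Rightarrow> real^2 \<Rightarrow> real \<Rightarrow> bool" where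
  "barrier e1 e2 c \<longleftrightarrow> (\<forall>z. e1 \<bullet> z = c \<longrightarrow> z \<in> \<Omega> \<and> H z *v e2 = 0)"

text \<open>If the segment up to the barrier stayed in the domain, its end point would be nonflat
  with \<open>k\<close> in the kernel, while the barrier adds the independent kernel vector
  \<open>e2\<close>.\<close>

lemma leaf_stops_before_barrier:
  assumes e: "orthonormal_basis e1 e2" and b: "barrier e1 e2 c"
    and q: "q \<in> \<Omega>" "H q *v e2 \<noteq> 0" and k: "norm k = 1" "H q *v k = 0"
  shows "\<exists>t\<in>closed_segment 0 ((c - e1 \<bullet> q) / (e1 \<bullet> k)). q + t *\<^sub>R k \<notin> \<Omega>"
proof (rule ccontr)
  let ?\<tau> = "(c - e1 \<bullet> q) / (e1 \<bullet> k)"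
  assume "\<not> ?thesis"
  then have seg: "\<And>t. t \<in> closed_segment 0 ?\<tau> \<Longrightarrow> q + t *\<^sub>R k \<in> \<Omega>"
    by blast
  obtain f where f: "orthonormal_basis f k"
    using orthonormal_basis_exists[OF k(1)] .
  have "q \<in> N"
    using q by (auto simp: nonflat_set_def)
  from hartman_nirenberg[OF this f k(2) connected_segment(1) _ seg]
  have 1: "q + ?\<tau> *\<^sub>R k \<in> N" "H (q + ?\<tau> *\<^sub>R k) *v k = 0"
    by auto
  \<comment> \<open>Otherwise \<open>k\<close> would be parallel to \<open>e2\<close>, which is not
    in the kernel at \<open>q\<close>. Thus \<open>?\<tau>\<close> is a genuine quotient and not the
    default value 0.\<close>
  have e1k: "e1 \<bullet> k \<noteq> 0"
  proof
    assume "e1 \<bullet> k = 0"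
    then have keq: "k = (e2 \<bullet> k) *\<^sub>R e2"
      using orthonormal_basis_expansion[OF e, of k] by simp
    then have "(e2 \<bullet> k) *\<^sub>R (H q *v e2) = 0"
      using k(2) by (metis matrix_vector_mult_scaleR)
    moreover have "e2 \<bullet> k \<noteq> 0"
      using keq k(1) by auto
    ultimately show False
      using q by simp
  qed
  then have "e1 \<bullet> (q + ?\<tau> *\<^sub>R k) = c"
    by (simp add: inner_add_right)
  then have "H (q + ?\<tau> *\<^sub>R k) *v e2 = 0"
    using b unfolding barrier_def by blast
  from matrix_eq_0_if_kernel[OF e this 1(2) e1k] 1(1) show False
    by (simp add: nonflat_set_def)
qed

text \<open>By symmetry, a kernel vector is orthogonal to the whole image of the Hessian. So this
  component of the gradient is stationary in every direction, not only along
  \<open>k\<close>.\<close>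

lemma inner_gradient_has_derivative_zero:
  assumes "z \<in> \<Omega>" "H z *v k = 0"
  shows "((\<lambda>z. k \<bullet> g z) has_derivative (\<lambda>h. 0)) (at z)"
proof -
  have "k \<bullet> (H z *v h) = 0" for h
    using H_symmetric[OF assms(1), of k h] assms(2) by simp
  then show ?thesis
    using has_derivative_inner_right[OF g_has_derivative[OF assms(1)], of k] by simp
qed

lemma u_has_derivative_along:
  assumes "z + t *\<^sub>R k \<in> \<Omega>"
  shows "((\<lambda>t. u (z + t *\<^sub>R k)) has_real_derivative k \<bullet> g (z + t *\<^sub>R k)) (at t)"
proof -
  have "((\<lambda>t. z + t *\<^sub>R k) has_derivative (\<lambda>t. t *\<^sub>R k)) (at t)"
    by (auto intro!: derivative_eq_intros)
  from has_derivative_compose[OF this u_has_derivative[OF assms]] show ?thesis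
    by (rule has_derivative_imp_has_field_derivative) (simp add: inner_commute)
qed

lemma u_affine_along_segment:
  assumes "\<tau> > 0" and "\<And>t. 0 \<le> t \<Longrightarrow> t \<le> \<tau> \<Longrightarrow> z + t *\<^sub>R k \<in> \<Omega> \<and> k \<bullet> g (z + t *\<^sub>R k) = v"
  shows "u (z + \<tau> *\<^sub>R k) = u z + v * \<tau>"
proof -
  have "((\<lambda>t. u (z + t *\<^sub>R k)) has_real_derivative v) (at t)" if "0 \<le> t" "t \<le> \<tau>" for t
    using u_has_derivative_along[of z t k] assms(2)[OF that] by simp
  from MVT2[OF assms(1) this] show ?thesis
    by (auto simp: algebra_simps)
qed

text \<open>The component of the gradient along \<open>e2\<close> is stationary on a connected set,
  hence a constant \<open>v0\<close>; integration along \<open>e2\<close> gives the linear term. The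
  function \<open>\<alpha>\<close> is the restriction of \<open>u\<close> to the axis of
  \<open>e1\<close>, so its derivatives are entries of the gradient and the Hessian.\<close>

lemma normal_form_in_strip:
  assumes e: "orthonormal_basis e1 e2" and I: "open_interval I"
    and S: "\<And>z. e1 \<bullet> z \<in> I \<Longrightarrow> z \<in> \<Omega> \<and> H z *v e2 = 0"
  shows "\<exists>\<alpha> v0. C2_on I \<alpha> \<and> (\<forall>x\<in>I. \<forall>y. u (x *\<^sub>R e1 + y *\<^sub>R e2) = \<alpha> x + v0 * y)"
proof -
  note ee = orthonormal_basis_inner[OF e]
  have "open I"
    using I by (simp add: open_interval_def)
  obtain x0 where x0: "x0 \<in> I"
    using I by (auto simp: open_interval_def)
  define v0 where "v0 = e2 \<bullet> g (x0 *\<^sub>R e1)"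
  have "open_strip (strip e1 e2 I)"
    using e I by (auto simp: open_strip_def)
  then have "open {z. e1 \<bullet> z \<in> I}" "connected {z. e1 \<bullet> z \<in> I}"
    using open_strip_open_convex convex_connected by (metis strip_eq[OF e])+
  then have v0: "e2 \<bullet> g z = v0" if "e1 \<bullet> z \<in> I" for z
    unfolding v0_def
    by (rule has_derivative_zero_unique_connected[of "{z. e1 \<bullet> z \<in> I}"])
      (use S x0 that ee in \<open>auto intro: inner_gradient_has_derivative_zero\<close>)
  define \<alpha> where "\<alpha> x = u (x *\<^sub>R e1)" for x
  have "u (x *\<^sub>R e1 + y *\<^sub>R e2) = \<alpha> x + v0 * y" if x: "x \<in> I" for x y
  proof -
    have in_strip: "e1 \<bullet> (x *\<^sub>R e1 + t *\<^sub>R e2) \<in> I" for t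
      using x ee by (simp add: inner_add_right)
    consider "y = 0" | "y > 0" | "y < 0" by linarith
    then show ?thesis
    proof cases
      case 1
      then show ?thesis by (simp add: \<alpha>_def)
    next
      case 2
      then show ?thesis
        using u_affine_along_segment[of y "x *\<^sub>R e1" e2 v0] S[OF in_strip] v0[OF in_strip]
        by (simp add: \<alpha>_def)
    next
      case 3
      \<comment> \<open>For negative \<open>y\<close> the segment is traversed upwards from its
        lower end, as \<open>u_affine_along_segment\<close> takes a positive length.\<close>
      have shift: "x *\<^sub>R e1 + y *\<^sub>R e2 + t *\<^sub>R e2 = x *\<^sub>R e1 + (y + t) *\<^sub>R e2" for t
        by (simp add: algebra_simps)
      have "u (x *\<^sub>R e1 + y *\<^sub>R e2 + (- y) *\<^sub>R e2) = u (x *\<^sub>R e1 + y *\<^sub>R e2) + v0 * (- y)"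
        unfolding shift
        using u_affine_along_segment[of "- y" "x *\<^sub>R e1 + y *\<^sub>R e2" e2 v0, unfolded shift]
          3 S[OF in_strip] v0[OF in_strip] by simp
      then show ?thesis
        by (simp add: \<alpha>_def)
    qed
  qed
  moreover have "C2_on I \<alpha>"
  proof (rule C2_on_realI[OF \<open>open I\<close>])
    have \<Omega>: "x *\<^sub>R e1 \<in> \<Omega>" if "x \<in> I" for x
      using S[of "x *\<^sub>R e1"] that ee by simp
    show "(\<alpha> has_real_derivative e1 \<bullet> g (x *\<^sub>R e1)) (at x)" if "x \<in> I" for x
      using u_has_derivative_along[of 0 x e1] \<Omega>[OF that] by (simp add: \<alpha>_def[abs_def])
    show "((\<lambda>x. e1 \<bullet> g (x *\<^sub>R e1)) has_real_derivative e1 \<bullet> (H (x *\<^sub>R e1) *v e1)) (at x)"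
      if "x \<in> I" for x
    proof -
      have "((\<lambda>t. t *\<^sub>R e1) has_derivative (\<lambda>t. t *\<^sub>R e1)) (at x)"
        by (auto intro!: derivative_eq_intros)
      from has_derivative_inner_right
          [OF has_derivative_compose[OF this g_has_derivative[OF \<Omega>[OF that]]], of e1]
      show ?thesis
        by (rule has_derivative_imp_has_field_derivative) (simp add: matrix_vector_mult_scaleR)
    qed
    show "continuous_on I (\<lambda>x. e1 \<bullet> (H (x *\<^sub>R e1) *v e1))"
      by (intro continuous_on_inner continuous_on_const continuous_on_compose2[OF continuous_on_H_mult]
          continuous_intros) (use \<Omega> in auto)
  qed
  ultimately show ?thesis
    by blast
qed

end

section \<open>Finitely many singularities\<close>

lemma negligible_segments:
  fixes X :: "(real^2) set"
  assumes "finite X"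
  shows "negligible (\<Union>(a, b)\<in>X \<times> X. closed_segment a b)"
proof (rule negligible_Union)
  show "finite ((\<lambda>(a, b). closed_segment a b) ` (X \<times> X))"
    using assms by simp
  show "negligible T" if "T \<in> (\<lambda>(a, b). closed_segment a b) ` (X \<times> X)" for T
    using that by (auto simp: negligible_convex_interior interior_closed_segment_ge2)
qed

lemma mem_closed_segment_on_line:
  fixes q k :: "'a::real_vector"
  assumes "s \<in> closed_segment a b"
  shows "q + s *\<^sub>R k \<in> closed_segment (q + a *\<^sub>R k) (q + b *\<^sub>R k)"
proof -
  obtain v where v: "0 \<le> v" "v \<le> 1" "s = (1 - v) * a + v * b"
    using assms by (auto simp: in_segment)
  have "q + s *\<^sub>R k = (1 - v) *\<^sub>R (q + a *\<^sub>R k) + v *\<^sub>R (q + b *\<^sub>R k)"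
    unfolding v(3) by (simp add: algebra_simps)
  then show ?thesis
    using v by (auto simp: in_segment)
qed

locale punctured_solution = degenerate_solution +
  fixes X :: "(real^2) set"
  assumes finite_X: "finite X"
    and dom_eq: "\<Omega> = UNIV - X"
    and singular: "\<And>P. P \<in> X \<Longrightarrow> C2_singular_at \<Omega> u P"
begin

text \<open>The point where a non-parallel leaf leaves the domain before the barrier would be a
  singular point projecting into the segment assumed free.\<close>

lemma vertical_kernel_without_singularities:
  assumes e: "orthonormal_basis e1 e2" and b: "barrier e1 e2 c"
    and q: "q \<in> \<Omega>" and free: "closed_segment (e1 \<bullet> q) c \<inter> (\<lambda>P. e1 \<bullet> P) ` X = {}"
  shows "H q *v e2 = 0"
proof (rule ccontr)
  assume H: "H q *v e2 \<noteq> 0"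
  obtain k where k: "norm k = 1" "H q *v k = 0"
    using kernel_exists[OF q] .
  let ?\<tau> = "(c - e1 \<bullet> q) / (e1 \<bullet> k)"
  obtain t where t: "t \<in> closed_segment 0 ?\<tau>" "q + t *\<^sub>R k \<in> X"
    using leaf_stops_before_barrier[OF e b q H k] dom_eq by blast
  show False
  proof (cases "e1 \<bullet> k = 0")
    case True
    \<comment> \<open>Division by zero gives 0, so the parameter segment is
      \<open>{0}\<close>.\<close>
    then have "q + t *\<^sub>R k = q"
      using t by simp
    then have "q \<in> X"
      using t(2) by metis
    then show False
      using q dom_eq by blast
  next
    case False
    have "e1 \<bullet> q + t *\<^sub>R (e1 \<bullet> k) \<in> closed_segment (e1 \<bullet> q + 0 *\<^sub>R (e1 \<bullet> k)) (e1 \<bullet> q + ?\<tau> *\<^sub>R (e1 \<bullet> k))"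
      by (rule mem_closed_segment_on_line[OF t(1)])
    then have "e1 \<bullet> (q + t *\<^sub>R k) \<in> closed_segment (e1 \<bullet> q) c"
      using False by (simp add: inner_add_right)
    then show False
      using free t(2) by blast
  qed
qed

lemma vertical_kernel_between_barriers:
  assumes e: "orthonormal_basis e1 e2" and b1: "barrier e1 e2 c1" and b2: "barrier e1 e2 c2"
    and z: "z \<in> \<Omega>" "c1 < e1 \<bullet> z" "e1 \<bullet> z < c2"
  shows "H z *v e2 = 0"
proof (rule ccontr)
  assume Hz: "H z *v e2 \<noteq> 0"
  define D where "D = (\<Omega> \<inter> (\<lambda>z. e1 \<bullet> z) -` {c1<..<c2}) \<inter> (\<lambda>z. H z *v e2) -` (- {0})"
  have slab: "open (\<Omega> \<inter> (\<lambda>z. e1 \<bullet> z) -` {c1<..<c2})"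
    by (intro open_Int open_dom open_vimage continuous_intros)
  have "open D"
    unfolding D_def
    by (rule continuous_open_preimage[OF continuous_on_subset[OF continuous_on_H_mult] slab]) auto
  moreover have "D \<subseteq> (\<Union>(a, b)\<in>X \<times> X. closed_segment a b)"
  proof
    fix q assume "q \<in> D"
    then have q: "q \<in> \<Omega>" "H q *v e2 \<noteq> 0" "c1 < e1 \<bullet> q" "e1 \<bullet> q < c2"
      by (auto simp: D_def)
    obtain k where k: "norm k = 1" "H q *v k = 0"
      using kernel_exists[OF q(1)] .
    obtain t1 where t1: "t1 \<in> closed_segment 0 ((c1 - e1 \<bullet> q) / (e1 \<bullet> k))" "q + t1 *\<^sub>R k \<in> X"
      using leaf_stops_before_barrier[OF e b1 q(1,2) k] dom_eq by blast
    obtain t2 where t2: "t2 \<in> closed_segment 0 ((c2 - e1 \<bullet> q) / (e1 \<bullet> k))" "q + t2 *\<^sub>R k \<in> X"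
      using leaf_stops_before_barrier[OF e b2 q(1,2) k] dom_eq by blast
    \<comment> \<open>The barriers lie on opposite sides of \<open>q\<close>, so the quotients have
      opposite signs and \<open>q\<close> lies between the two singular points. The case
      \<open>e1 \<bullet> k = 0\<close> is harmless, as both quotients are then 0.\<close>
    have "0 \<in> closed_segment t1 t2"
    proof (cases "e1 \<bullet> k \<ge> 0")
      case True
      then have "(c1 - e1 \<bullet> q) / (e1 \<bullet> k) \<le> 0" "(c2 - e1 \<bullet> q) / (e1 \<bullet> k) \<ge> 0"
        using q by (auto simp: divide_nonpos_nonneg)
      then show ?thesis
        using t1 t2 by (auto simp: closed_segment_eq_real_ivl split: if_splits)
    next
      case False
      then have "(c1 - e1 \<bullet> q) / (e1 \<bullet> k) \<ge> 0" "(c2 - e1 \<bullet> q) / (e1 \<bullet> k) \<le> 0"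
        using q by (auto simp: divide_nonneg_nonpos divide_nonpos_nonpos)
      then show ?thesis
        using t1 t2 by (auto simp: closed_segment_eq_real_ivl split: if_splits)
    qed
    from mem_closed_segment_on_line[OF this, of q k]
    have "q \<in> closed_segment (q + t1 *\<^sub>R k) (q + t2 *\<^sub>R k)"
      by simp
    then show "q \<in> (\<Union>(a, b)\<in>X \<times> X. closed_segment a b)"
      using t1 t2 by blast
  qed
  ultimately have "D = {}"
    using negligible_segments[OF finite_X] negligible_subset open_not_negligible by blast
  then show False
    using z Hz by (auto simp: D_def)
qed

text \<open>Refutes \<open>C2_singular_at\<close> by an explicit extension: a vertical translate of
  \<open>u\<close>, corrected by a constant, is regular at \<open>P\<close> and agrees with
  \<open>u\<close> around it.\<close>

lemma no_singularity_between_barriers: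
  assumes e: "orthonormal_basis e1 e2" and b1: "barrier e1 e2 c1" and b2: "barrier e1 e2 c2"
    and P: "c1 < e1 \<bullet> P" "e1 \<bullet> P < c2"
  shows "P \<notin> X"
proof
  assume "P \<in> X"
  note ee = orthonormal_basis_inner[OF e]
  have ne2: "norm e2 = 1"
    using e by (simp add: orthonormal_basis_def)
  define T where "T = {z. c1 < e1 \<bullet> z \<and> e1 \<bullet> z < c2}"
  have "T = (\<lambda>z. e1 \<bullet> z) -` {c1<..<c2}"
    by (auto simp: T_def)
  then have T: "open T" "connected T"
    by (auto intro!: open_vimage continuous_intros convex_connected convex_linear_vimage
        bounded_linear.linear bounded_linear_inner_right)
  have "open (T - X)"
    using T(1) finite_X by (simp add: finite_imp_closed open_Diff)
  \<comment> \<open>Ensures the same constant \<open>v\<close> above, below and on both sides of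
    \<open>P\<close>.\<close>
  have "connected (T - X)"
    using T finite_X by (intro connected_open_diff_countable) (auto simp: countable_finite)
  have der: "((\<lambda>z. e2 \<bullet> g z) has_derivative (\<lambda>h. 0)) (at z)" if "z \<in> T - X" for z
    using that vertical_kernel_between_barriers[OF e b1 b2, of z] dom_eq
    by (intro inner_gradient_has_derivative_zero) (auto simp: T_def)
  have "open (T - (X - {P}))"
    using T(1) finite_X by (simp add: finite_imp_closed open_Diff)
  moreover have "P \<in> T - (X - {P})"
    using P by (simp add: T_def)
  ultimately obtain \<rho> where \<rho>: "\<rho> > 0" "ball P \<rho> \<subseteq> T - (X - {P})"
    using open_contains_ball by blast
  define \<tau> where "\<tau> = \<rho> / 2"
  have \<tau>: "\<tau> > 0" "\<tau> + \<tau> = \<rho>"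
    using \<rho> by (simp_all add: \<tau>_def)
  have near: "z \<in> T - X" if "dist z P < \<rho>" "z \<noteq> P" for z
    using that \<rho>(2) by (auto simp: dist_commute)
  have shift_dist: "dist (z + t *\<^sub>R e2) P < \<rho>" if "dist z P < \<tau>" "\<bar>t\<bar> \<le> \<tau>" for z t
  proof -
    have "dist (z + t *\<^sub>R e2) P \<le> norm (t *\<^sub>R e2) + dist z P"
      using norm_triangle_ineq[of "t *\<^sub>R e2" "z - P"] by (simp add: dist_norm algebra_simps)
    then show ?thesis
      using that ne2 \<tau> by simp
  qed
  \<comment> \<open>The shift has length exactly \<open>\<tau>\<close>, so it moves no point of the
    open ball of radius \<open>\<tau>\<close> onto \<open>P\<close>; by \<open>shift_dist\<close> it
    also stays in the larger ball of radius \<open>\<rho>\<close>.\<close>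
  have shift_ne: "z + \<tau> *\<^sub>R e2 \<noteq> P" if "dist z P < \<tau>" for z
  proof
    assume "z + \<tau> *\<^sub>R e2 = P"
    then have "dist z P = norm (\<tau> *\<^sub>R e2)"
      by (auto simp: dist_norm)
    then show False
      using that ne2 \<tau> by simp
  qed
  define v where "v = e2 \<bullet> g (P + \<tau> *\<^sub>R e2)"
  have v: "e2 \<bullet> g z = v" if "z \<in> T - X" for z
    unfolding v_def
    using has_derivative_zero_unique_connected[OF \<open>open (T - X)\<close> \<open>connected (T - X)\<close> der that]
      near[OF shift_dist shift_ne, of P] \<tau> by simp
  \<comment> \<open>Near \<open>P\<close>, \<open>u\<close> agrees with a translate of itself (up to a constant) that is regular at \<open>P\<close>;
    vertical segments through \<open>P\<close> are reached by continuity.\<close>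
  have generic: "u z = u (z + \<tau> *\<^sub>R e2) + - v * \<tau>" if z: "dist z P < \<tau>" "e1 \<bullet> z \<noteq> e1 \<bullet> P" for z
  proof -
    have "z + t *\<^sub>R e2 \<in> T - X" if "0 \<le> t" "t \<le> \<tau>" for t
    proof (rule near)
      show "dist (z + t *\<^sub>R e2) P < \<rho>"
        using shift_dist[OF z(1)] that by simp
      have "e1 \<bullet> (z + t *\<^sub>R e2) \<noteq> e1 \<bullet> P"
        using z(2) ee by (simp add: inner_add_right)
      then show "z + t *\<^sub>R e2 \<noteq> P"
        by blast
    qed
    then show ?thesis
      using u_affine_along_segment[OF \<tau>(1), of z e2 v] v dom_eq by auto
  qed
  have eq: "u z = u (z + \<tau> *\<^sub>R e2) + - v * \<tau>" if z: "dist z P < \<tau>" "z \<noteq> P" for z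
  proof (cases "e1 \<bullet> z = e1 \<bullet> P")
    case False
    then show ?thesis
      using generic z by blast
  next
    case True
    let ?f = "\<lambda>w. u w - u (w + \<tau> *\<^sub>R e2) + v * \<tau>"
    have cont: "isCont u w" if "w \<in> \<Omega>" for w
      using u_has_derivative[OF that] has_derivative_continuous by blast
    have "dist z P < \<rho>"
      using z \<tau> by simp
    then have "z \<in> \<Omega>" "z + \<tau> *\<^sub>R e2 \<in> \<Omega>"
      using near[of z] near[OF shift_dist[OF z(1)] shift_ne[OF z(1)]] z \<tau> dom_eq by auto
    then have "isCont u z" "isCont (\<lambda>w. u (w + \<tau> *\<^sub>R e2)) z"
      using cont by (auto intro!: isCont_o2[where f = "\<lambda>w. w + \<tau> *\<^sub>R e2" and g = u])
    then have f: "(?f \<longlongrightarrow> ?f z) (nhds z)"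
      by (intro tendsto_intros) (simp_all add: isCont_def tendsto_nhds_iff)
    have lim: "((\<lambda>\<epsilon>. z + \<epsilon> *\<^sub>R e1) \<longlongrightarrow> z + 0 *\<^sub>R e1) (at (0::real))"
      by (intro tendsto_intros)
    then have "((\<lambda>\<epsilon>. ?f (z + \<epsilon> *\<^sub>R e1)) \<longlongrightarrow> ?f z) (at 0)"
      using filterlim_compose[OF f, of "\<lambda>\<epsilon>. z + \<epsilon> *\<^sub>R e1" "at 0"] by simp
    moreover have "\<forall>\<^sub>F \<epsilon> in at 0. ?f (z + \<epsilon> *\<^sub>R e1) = 0"
    proof -
      have "\<forall>\<^sub>F \<epsilon> in at 0. z + \<epsilon> *\<^sub>R e1 \<in> ball P \<tau>"
        using topological_tendstoD[OF lim open_ball] z by (simp add: dist_commute)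
      moreover have "\<forall>\<^sub>F \<epsilon> in at (0::real). \<epsilon> \<noteq> 0"
        by (rule eventually_neq_at_within)
      ultimately show ?thesis
      proof eventually_elim
        case (elim \<epsilon>)
        then show ?case
          using generic[of "z + \<epsilon> *\<^sub>R e1"] True ee by (simp add: dist_commute inner_add_right)
      qed
    qed
    then have "((\<lambda>\<epsilon>. ?f (z + \<epsilon> *\<^sub>R e1)) \<longlongrightarrow> 0) (at 0)"
      by (rule tendsto_eventually)
    ultimately have "?f z = 0"
      using tendsto_unique[OF at_neq_bot] by blast
    then show ?thesis
      by simp
  qed
  define w where "w z = (if z = P then u (P + \<tau> *\<^sub>R e2) + - v * \<tau> else u z)" for z
  have wu: "w z = u z" if "z \<in> \<Omega>" for z
    using that \<open>P \<in> X\<close> dom_eq by (auto simp: w_def)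
  have "C2_on \<Omega> w"
    by (rule C2_on_cong_open[OF open_dom _ C2]) (simp add: wu)
  moreover have "C2_on (ball P \<tau>) w"
  proof (rule C2_on_cong_open[OF open_ball])
    show "C2_on (ball P \<tau>) (\<lambda>z. u (z + \<tau> *\<^sub>R e2) + - v * \<tau>)"
      using near[OF shift_dist shift_ne] \<tau> dom_eq
      by (intro C2_on_shift[OF C2]) (auto simp: dist_commute)
    show "u (z + \<tau> *\<^sub>R e2) + - v * \<tau> = w z" if "z \<in> ball P \<tau>" for z
      using eq[of z] that by (auto simp: w_def dist_commute)
  qed
  ultimately have "C2_on (\<Omega> \<union> ball P \<tau>) w"
    by (intro C2_on_Un_open open_dom open_ball)
  moreover have "\<Omega> \<union> ball P \<tau> = insert P \<Omega>"
    using near \<tau> dom_eq by (force simp: dist_commute)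
  ultimately show False
    using singular[OF \<open>P \<in> X\<close>] wu unfolding C2_singular_at_def by auto
qed

text \<open>A non-parallel \<open>r\<close> would meet the nonflat line, where \<open>k\<close> and
  \<open>e2\<close> would both be in the kernel. Only \<open>H z *v k = 0\<close> is asked along
  \<open>r\<close>, so linear leaves and flat lines are treated together.\<close>

lemma line_parallel_to_leaf:
  assumes e: "orthonormal_basis e1 e2"
    and L: "\<And>z. e1 \<bullet> z = x0 \<Longrightarrow> z \<in> N \<and> H z *v e2 = 0"
    and r: "r = range (\<lambda>t. b + t *\<^sub>R k)" "norm k = 1" "\<And>z. z \<in> r \<Longrightarrow> z \<in> \<Omega> \<and> H z *v k = 0"
  shows "r = {z. e1 \<bullet> z = e1 \<bullet> b}" "barrier e1 e2 (e1 \<bullet> b)"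
proof -
  have e1k: "e1 \<bullet> k = 0"
  proof (rule ccontr)
    assume nz: "e1 \<bullet> k \<noteq> 0"
    define z where "z = b + ((x0 - e1 \<bullet> b) / (e1 \<bullet> k)) *\<^sub>R k"
    have "e1 \<bullet> z = x0"
      using nz by (simp add: z_def inner_add_right)
    moreover have "z \<in> r"
      unfolding r z_def by blast
    ultimately show False
      using matrix_eq_0_if_kernel[OF e, of "H z" k] L[of z] r(3)[of z] nz
      by (auto simp: nonflat_set_def)
  qed
  then have k_eq: "k = (e2 \<bullet> k) *\<^sub>R e2"
    using orthonormal_basis_expansion[OF e, of k] by simp
  define c where "c = e2 \<bullet> k"
  have c: "c \<noteq> 0" "k = c *\<^sub>R e2"
    using k_eq r(2) by (auto simp: c_def)
  have "r = range (\<lambda>t. b + t *\<^sub>R e2)"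
    unfolding r(1)
  proof (intro subset_antisym image_subsetI)
    show "b + t *\<^sub>R k \<in> range (\<lambda>t. b + t *\<^sub>R e2)" for t
      by (rule range_eqI[of _ _ "t * c"]) (simp add: c(2))
    show "b + t *\<^sub>R e2 \<in> range (\<lambda>t. b + t *\<^sub>R k)" for t
      using c by (intro range_eqI[of _ _ "t / c"]) simp
  qed
  then show r_eq: "r = {z. e1 \<bullet> z = e1 \<bullet> b}"
    using line_eq_level_set[OF e] by simp
  have "H z *v e2 = 0" if "z \<in> r" for z
  proof -
    have "c *\<^sub>R (H z *v e2) = 0"
      using r(3)[OF that] c by (simp add: matrix_vector_mult_scaleR)
    then show ?thesis
      using c by simp
  qed
  then show "barrier e1 e2 (e1 \<bullet> b)"
    using r(3) r_eq by (auto simp: barrier_def)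
qed

text \<open>Singular points project neither between the barriers nor onto \<open>c1\<close> or
  \<open>c2\<close>, since barriers lie in the domain. With \<open>maximal_strip_eq\<close> this
  places the second barrier in the maximal strip around the first.\<close>

lemma barriers_in_same_component:
  assumes e: "orthonormal_basis e1 e2" and b: "barrier e1 e2 c1" "barrier e1 e2 c2"
  shows "c2 \<in> connected_component_set (- (\<lambda>P. e1 \<bullet> P) ` X) c1"
proof -
  have "e1 \<bullet> P \<notin> closed_segment c1 c2" if "P \<in> X" for P
  proof
    assume "e1 \<bullet> P \<in> closed_segment c1 c2"
    moreover have "e1 \<bullet> P \<noteq> c1" "e1 \<bullet> P \<noteq> c2"
      using b that dom_eq unfolding barrier_def by blast+
    ultimately have "c1 < e1 \<bullet> P \<and> e1 \<bullet> P < c2 \<or> c2 < e1 \<bullet> P \<and> e1 \<bullet> P < c1"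
      by (auto simp: closed_segment_eq_real_ivl split: if_splits)
    then show False
      using no_singularity_between_barriers[OF e] b that by blast
  qed
  then have "closed_segment c1 c2 \<subseteq> connected_component_set (- (\<lambda>P. e1 \<bullet> P) ` X) c1"
    by (intro connected_component_maximal) auto
  then show ?thesis
    by auto
qed

theorem linear_leaf_strip:
  assumes a: "a \<in> N" and line: "is_line (leaf \<Omega> u a)"
    and S: "S = maximal_strip \<Omega> (leaf \<Omega> u a)"
  shows "(\<exists>e1 e2 I \<alpha> v0.
            orthonormal_basis e1 e2 \<and> affine_parallel (span {e2}) (leaf \<Omega> u a) \<and>
            open_interval I \<and> S = strip e1 e2 I \<and> C2_on I \<alpha> \<and>
            (\<forall>x\<in>I. \<forall>y. u (x *\<^sub>R e1 + y *\<^sub>R e2) = \<alpha> x + v0 * y))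
       \<and> (\<forall>q\<in>N. is_line (leaf \<Omega> u q) \<longrightarrow> leaf \<Omega> u q \<subseteq> S)
       \<and> (\<forall>r. is_line r \<and> r \<subseteq> flat_set \<Omega> u \<longrightarrow> r \<subseteq> S)"
proof -
  obtain e2 where e2: "norm e2 = 1" "leaf \<Omega> u a = range (\<lambda>t. a + t *\<^sub>R e2)"
    "leaf \<Omega> u a \<subseteq> N" "\<And>z. z \<in> leaf \<Omega> u a \<Longrightarrow> H z *v e2 = 0"
    using leaf_is_line[OF a line] by blast
  obtain e1 where e: "orthonormal_basis e1 e2"
    using orthonormal_basis_exists[OF e2(1)] .
  have leaf_eq: "leaf \<Omega> u a = {z. e1 \<bullet> z = e1 \<bullet> a}"
    using e2(2) line_eq_level_set[OF e] by simp
  have L: "z \<in> N \<and> H z *v e2 = 0" if "e1 \<bullet> z = e1 \<bullet> a" for z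
    using that e2(3,4) leaf_eq by auto
  then have barrier_a: "barrier e1 e2 (e1 \<bullet> a)"
    by (auto simp: barrier_def nonflat_set_def)
  define I where "I = connected_component_set (- (\<lambda>P. e1 \<bullet> P) ` X) (e1 \<bullet> a)"
  have "e1 \<bullet> a \<notin> (\<lambda>P. e1 \<bullet> P) ` X"
  proof
    assume "e1 \<bullet> a \<in> (\<lambda>P. e1 \<bullet> P) ` X"
    then obtain P where "P \<in> X" "e1 \<bullet> P = e1 \<bullet> a"
      by auto
    then show False
      using L[of P] dom_eq by (auto simp: nonflat_set_def)
  qed
  from maximal_strip_eq[OF e finite_X this]
  have I: "open_interval I" and S_eq: "S = strip e1 e2 I"
    using S e2(2) dom_eq by (simp_all add: I_def)
  have IX: "I \<inter> (\<lambda>P. e1 \<bullet> P) ` X = {}"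
    using connected_component_subset unfolding I_def by blast
  \<comment> \<open>The case of two equal barriers.\<close>
  have aI: "e1 \<bullet> a \<in> I"
    using barriers_in_same_component[OF e barrier_a barrier_a] by (simp add: I_def)
  have "z \<in> \<Omega> \<and> H z *v e2 = 0" if z: "e1 \<bullet> z \<in> I" for z
  proof
    show "z \<in> \<Omega>"
      using z IX dom_eq by blast
    moreover have "closed_segment (e1 \<bullet> z) (e1 \<bullet> a) \<subseteq> I"
      using z aI I closed_segment_subset[of "e1 \<bullet> z" I "e1 \<bullet> a"]
      by (simp add: open_interval_def is_interval_convex_1)
    ultimately show "H z *v e2 = 0"
      using vertical_kernel_without_singularities[OF e barrier_a] IX by blast
  qed
  from normal_form_in_strip[OF e I this] obtain \<alpha> v0 where
    "C2_on I \<alpha> \<and> (\<forall>x\<in>I. \<forall>y. u (x *\<^sub>R e1 + y *\<^sub>R e2) = \<alpha> x + v0 * y)"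
    by blast
  moreover have "affine_parallel (span {e2}) (leaf \<Omega> u a)"
    unfolding affine_parallel_def e2(2) span_singleton by (auto simp: image_image)
  ultimately have 1: "\<exists>e1 e2 I \<alpha> v0.
            orthonormal_basis e1 e2 \<and> affine_parallel (span {e2}) (leaf \<Omega> u a) \<and>
            open_interval I \<and> S = strip e1 e2 I \<and> C2_on I \<alpha> \<and>
            (\<forall>x\<in>I. \<forall>y. u (x *\<^sub>R e1 + y *\<^sub>R e2) = \<alpha> x + v0 * y)"
    using e I S_eq by blast
  \<comment> \<open>Serves both inclusions: on a linear leaf the direction \<open>k\<close> is in
    the kernel, and on a flat line every direction is.\<close>
  have in_S: "r \<subseteq> S"
    if "r = range (\<lambda>t. b + t *\<^sub>R k)" "norm k = 1" "\<And>z. z \<in> r \<Longrightarrow> z \<in> \<Omega> \<and> H z *v k = 0" for r b k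
  proof -
    note r = line_parallel_to_leaf[OF e L that]
    have "e1 \<bullet> b \<in> I"
      using barriers_in_same_component[OF e barrier_a r(2)] by (simp add: I_def)
    then show ?thesis
      unfolding S_eq strip_eq[OF e] using r(1) by auto
  qed
  have 2: "leaf \<Omega> u q \<subseteq> S" if q: "q \<in> N" "is_line (leaf \<Omega> u q)" for q
  proof -
    obtain k where "norm k = 1" "leaf \<Omega> u q = range (\<lambda>t. q + t *\<^sub>R k)"
      "leaf \<Omega> u q \<subseteq> N" "\<And>z. z \<in> leaf \<Omega> u q \<Longrightarrow> H z *v k = 0"
      using leaf_is_line[OF q] by blast
    then show ?thesis
      by (intro in_S) (auto simp: nonflat_set_def)
  qed
  have 3: "r \<subseteq> S" if r: "is_line r" "r \<subseteq> flat_set \<Omega> u" for r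
  proof -
    have "r \<noteq> {}"
      using r(1) by (auto simp: is_line_def)
    then obtain b where "b \<in> r"
      by blast
    from is_line_direction[OF r(1) this]
    obtain k where k: "norm k = 1" "r = range (\<lambda>t. b + t *\<^sub>R k)" .
    have "z \<in> \<Omega> \<and> H z *v k = 0" if "z \<in> r" for z
      using r(2) that by (auto simp: flat_set_def nonflat_set_def)
    then show ?thesis
      using in_S[OF k(2,1)] by blast
  qed
  show ?thesis
    using 1 2 3 by blast
qed

end

theorem proposition1:
  fixes n :: nat and p :: "nat \<Rightarrow> real^2" and u :: "real^2 \<Rightarrow> real"
    and \<Omega> S :: "(real^2) set" and a :: "real^2"
  assumes "inj_on p {1..n}"
    and "\<Omega> = UNIV - p ` {1..n}"
    and "C2_on \<Omega> u"
    and "degenerate_monge_ampere_on \<Omega> u"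
    and "\<forall>i\<in>{1..n}. C2_singular_at \<Omega> u (p i)"
    and "a \<in> nonflat_set \<Omega> u"
    and "is_line (leaf \<Omega> u a)"
    and "S = maximal_strip \<Omega> (leaf \<Omega> u a)"
  shows "(\<exists>e1 e2 I \<alpha> v0.
            orthonormal_basis e1 e2 \<and> affine_parallel (span {e2}) (leaf \<Omega> u a) \<and>
            open_interval I \<and> S = strip e1 e2 I \<and> C2_on I \<alpha> \<and>
            (\<forall>x\<in>I. \<forall>y. u (x *\<^sub>R e1 + y *\<^sub>R e2) = \<alpha> x + v0 * y))
       \<and> (\<forall>q\<in>nonflat_set \<Omega> u. is_line (leaf \<Omega> u q) \<longrightarrow> leaf \<Omega> u q \<subseteq> S)
       \<and> (\<forall>r. is_line r \<and> r \<subseteq> flat_set \<Omega> u \<longrightarrow> r \<subseteq> S)"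
proof -
  interpret punctured_solution \<Omega> u "p ` {1..n}"
    using assms(2-5) by unfold_locales (auto simp: finite_imp_closed open_Diff)
  show ?thesis
    by (rule linear_leaf_strip[OF assms(6-8)])
qed

end
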